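(* Let $E$ be a finite set, let $\nu_1,\nu_2: 2^E \to \mathbb{R}\cup\{-\infty\}$ be two $M^\natural$-concave functions, and let $\nu=\nu_1+\nu_2$. Let $q$ be a real number with $0<q\leq 1$, and for each integer $k$ put $$I_{q,\nu;k}=\sum_{I\in \binom{E}{k}}q^{-\nu(I)}.$$ Then for every integer $k$ with $0\leq k\leq |E|-2$, $$\frac{I_{q,\nu;k}}{\binom{|E|}{k}}\cdot \frac{I_{q,\nu;k+2}}{\binom{|E|}{k+2}}\leq \left(\frac{I_{q,\nu;k+1}}{\binom{|E|}{k+1}}\right)^2.$$
   Context: $2^E$ denotes the set of subsets of $E$, and $\binom{E}{k}$ the set of subsets of $E$ of size $k$. A function $\nu: 2^E \to \mathbb{R}\cup \{-\infty\}$ is called $M^\natural$-concave if for all $I_1,I_2\subseteq E$ and all $i_1 \in I_1\setminus I_2$ at least one of the following holds: (1) $\nu(I_1) + \nu(I_2) \leq \nu(I_1\setminus \{i_1\}) + \nu(I_2 \cup \{i_1\})$; (2) there is $i_2 \in I_2\setminus I_1$ such that $\nu(I_1) + \nu(I_2) \leq \nu((I_1\setminus \{i_1\}) \cup \{i_2\}) + \nu((I_2 \setminus \{i_2\}) \cup \{i_1\})$. Conventions: $-\infty + a = -\infty$ for all $a\in\mathbb{R}\cup\{-\infty\}$, $-\infty\le a$ for all $a$, and $q^{-\nu(I)}=0$ whenever $\nu(I)=-\infty$ (for every $0<q\leq 1$, including $q=1$). *)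

theory Defs
  imports Complex_Main "HOL-Library.Extended_Real"
begin

text \<open>
  Functions \<open>2^E \<Rightarrow> \<real> \<union> {-\<infinity>}\<close> are rendered as functions of type \<open>'a set \<Rightarrow> ereal\<close> that
  avoid \<open>\<infinity>\<close> on subsets of \<open>E\<close>; their values outside \<open>Pow E\<close> are irrelevant.
  With \<open>\<infinity>\<close> excluded, \<open>ereal\<close> addition and order satisfy \<open>-\<infinity> + a = -\<infinity>\<close> and \<open>-\<infinity> \<le> a\<close>.
\<close>

definition M_natural_concave :: "'a set \<Rightarrow> ('a set \<Rightarrow> ereal) \<Rightarrow> bool" where
  "M_natural_concave E \<nu> \<longleftrightarrow>
     (\<forall>I \<subseteq> E. \<nu> I \<noteq> \<infinity>) \<and>
     (\<forall>I1 I2 i1. I1 \<subseteq> E \<longrightarrow> I2 \<subseteq> E \<longrightarrow> i1 \<in> I1 - I2 \<longrightarrow>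
        \<nu> I1 + \<nu> I2 \<le> \<nu> (I1 - {i1}) + \<nu> (I2 \<union> {i1}) \<or>
        (\<exists>i2 \<in> I2 - I1.
           \<nu> I1 + \<nu> I2 \<le> \<nu> ((I1 - {i1}) \<union> {i2}) + \<nu> ((I2 - {i2}) \<union> {i1})))"

text \<open>\<open>q_neg_pow q x\<close> is \<open>q\<^sup>-\<^sup>x\<close>, read as \<open>0\<close> at \<open>x = -\<infinity>\<close>, also for \<open>q = 1\<close>.\<close>

definition q_neg_pow :: "real \<Rightarrow> ereal \<Rightarrow> real" where
  "q_neg_pow q x = (if x = -\<infinity> then 0 else q powr (- real_of_ereal x))"

definition I_sum :: "'a set \<Rightarrow> real \<Rightarrow> ('a set \<Rightarrow> ereal) \<Rightarrow> nat \<Rightarrow> real" where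
  "I_sum E q \<nu> k = (\<Sum>I \<in> {I. I \<subseteq> E \<and> card I = k}. q_neg_pow q (\<nu> I))"

end

theory Submission
  imports Defs "HOL-Analysis.Function_Topology" "HOL-Library.Multiset"
begin

text \<open>
  Put \<open>n = |E|\<close> and \<open>w\<^sub>i I = q powr (- \<nu>\<^sub>i I)\<close>. The polynomials \<open>F = \<Sum>I. w\<^sub>1 I x\<^sup>I y^(n - |I|)\<close> and
  \<open>G = \<Sum>I. w\<^sub>2 I x'^(E - I) z^|I|\<close> are Lorentzian: their derivatives of order \<open>n - 2\<close> are
  quadratic forms with at most one positive eigenvalue, because rescaling turns them into
  ultrametric distance matrices, which are conditionally negative. By the local-to-global principle
  for Lorentzian polynomials, the Alexandrov--Fenchel inequality holds for the mixed derivatives of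
  \<open>F G\<close> in nonnegative directions.
  Differentiating \<open>F G\<close> along \<open>\<partial>/\<partial>x\<^sub>e + \<partial>/\<partial>x'\<^sub>e\<close> for all \<open>e \<in> E\<close> leaves \<open>\<Sum>k. I\<^sub>k y^(n - k) z^k\<close>, and
  Alexandrov--Fenchel in the directions \<open>y\<close> and \<open>z\<close> is the claim.
\<close>

subsection \<open>Quadratic forms with at most one positive eigenvalue\<close>

text \<open>The product F G keeps the two weights apart, and the complement in G recombines them:
  the derivative along \<partial>/\<partial>x_e + \<partial>/\<partial>x'_e assigns each e to
  exactly one factor, S to F and E - S to G, which selects w1 S * w2 S. The binomial coefficients
  come from the homogenizing variables: extracting y^(n - k) z^k by differentiation costs (n - k)!
  k!, which is n! divided by the binomial coefficient. The values -\<infinity> are the main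
  obstacle. Weights equal to 0 can make a matrix of mixed derivatives reducible, while the
  Perron--Frobenius step needs irreducibility; connectedness of the support therefore has to be
  derived from the exchange property, for one polynomial and then for the product. The same step
  needs strictly positive directions, whereas all directions used here have zero coordinates; a
  limit bridges the gap.\<close>

definition bform :: "'v set \<Rightarrow> ('v \<Rightarrow> 'v \<Rightarrow> real) \<Rightarrow> ('v \<Rightarrow> real) \<Rightarrow> ('v \<Rightarrow> real) \<Rightarrow> real" where
  "bform V M x y = (\<Sum>i\<in>V. \<Sum>j\<in>V. M i j * x i * y j)"

text \<open>Reversed Cauchy--Schwarz: for symmetric M it says that no plane carries a positive
  definite restriction of the form, which is the eigenvalue condition without eigenvalues.\<close>

definition lorentzian :: "'v set \<Rightarrow> ('v \<Rightarrow> 'v \<Rightarrow> real) \<Rightarrow> bool" where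
  "lorentzian V M \<longleftrightarrow>
     (\<forall>x y. 0 < bform V M y y \<longrightarrow> bform V M x x * bform V M y y \<le> (bform V M x y)\<^sup>2)"

lemma bform_add_left: "bform V M (\<lambda>i. x i + y i) z = bform V M x z + bform V M y z"
  by (simp add: bform_def algebra_simps sum.distrib)

lemma bform_add_right: "bform V M z (\<lambda>i. x i + y i) = bform V M z x + bform V M z y"
  by (simp add: bform_def algebra_simps sum.distrib)

lemma bform_scale_left: "bform V M (\<lambda>i. c * x i) z = c * bform V M x z"
  by (simp add: bform_def sum_distrib_left mult_ac)

lemma bform_scale_right: "bform V M z (\<lambda>i. c * x i) = c * bform V M z x"
  by (simp add: bform_def sum_distrib_left mult_ac)

lemma bform_commute:
  assumes "\<And>i j. i \<in> V \<Longrightarrow> j \<in> V \<Longrightarrow> M i j = M j i"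
  shows "bform V M x y = bform V M y x"
proof -
  have "bform V M x y = (\<Sum>j\<in>V. \<Sum>i\<in>V. M i j * x i * y j)"
    unfolding bform_def by (rule sum.swap)
  also have "\<dots> = bform V M y x"
    unfolding bform_def using assms by (intro sum.cong refl) (simp add: mult_ac)
  finally show ?thesis .
qed

lemma bform_combination:
  assumes "\<And>i j. i \<in> V \<Longrightarrow> j \<in> V \<Longrightarrow> M i j = M j i"
  shows "bform V M (\<lambda>i. s * x i + t * y i) (\<lambda>i. s * x i + t * y i)
    = s\<^sup>2 * bform V M x x + 2 * s * t * bform V M x y + t\<^sup>2 * bform V M y y"
  using bform_commute[of V M y x, OF assms]
  by (simp add: bform_add_left bform_add_right bform_scale_left bform_scale_right
      algebra_simps power2_eq_square)

lemma bform_rows: "bform V M x y = (\<Sum>i\<in>V. x i * (\<Sum>j\<in>V. M i j * y j))"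
  by (simp add: bform_def sum_distrib_left mult_ac)

text \<open>Completing the square. Applied to two vectors that violate the reversed Cauchy--Schwarz
  inequality, it says that the form is positive definite on their span.\<close>

lemma posdef_binary_quadratic:
  fixes A B C s t :: real
  assumes "0 < A" "B\<^sup>2 < A * C" "s\<^sup>2 * A + 2 * s * t * B + t\<^sup>2 * C \<le> 0"
  shows "s = 0 \<and> t = 0"
proof -
  have eq: "A * (s\<^sup>2 * A + 2 * s * t * B + t\<^sup>2 * C) = (A * s + B * t)\<^sup>2 + t\<^sup>2 * (A * C - B\<^sup>2)"
    by (simp add: power2_eq_square algebra_simps)
  have le: "A * (s\<^sup>2 * A + 2 * s * t * B + t\<^sup>2 * C) \<le> 0"
    using assms by (simp add: mult_nonneg_nonpos)
  have "0 \<le> t\<^sup>2 * (A * C - B\<^sup>2)" using assms by simp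
  with le eq have "t\<^sup>2 * (A * C - B\<^sup>2) = 0" "(A * s + B * t)\<^sup>2 = 0"
    using zero_le_power2[of "A * s + B * t"] by linarith+
  then show ?thesis using assms by auto
qed

lemma lorentzianI_nonpos_on_perp:
  assumes sym: "\<And>i j. i \<in> V \<Longrightarrow> j \<in> V \<Longrightarrow> M i j = M j i"
    and neg: "\<And>x. bform V M x v = 0 \<Longrightarrow> bform V M x x \<le> 0"
  shows "lorentzian V M"
  unfolding lorentzian_def
proof (intro allI impI, rule ccontr)
  fix x y
  assume y: "0 < bform V M y y" and "\<not> bform V M x x * bform V M y y \<le> (bform V M x y)\<^sup>2"
  then have lt: "(bform V M x y)\<^sup>2 < bform V M x x * bform V M y y" by simp
  then have "0 < bform V M x x * bform V M y y"
    using zero_le_power2[of "bform V M x y"] by linarith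
  then have x: "0 < bform V M x x"
    using y by (simp add: zero_less_mult_iff)
  \<comment> \<open>This combination of x and y is orthogonal to v. Positive definiteness forces s =
    0, so y itself is orthogonal to v, against its positive square.\<close>
  define s t where "s = bform V M y v" and "t = - bform V M x v"
  have "bform V M (\<lambda>i. s * x i + t * y i) v = 0"
    by (simp only: bform_add_left bform_scale_left) (simp add: s_def t_def)
  from neg[OF this] have "s\<^sup>2 * bform V M x x + 2 * s * t * bform V M x y + t\<^sup>2 * bform V M y y \<le> 0"
    by (simp add: bform_combination[OF sym])
  from posdef_binary_quadratic[OF x lt this] have "bform V M y v = 0"
    by (simp add: s_def)
  from neg[OF this] y show False by simp
qed

lemma bform_superset:
  assumes "finite V'" "V \<subseteq> V'"
    "\<And>i j. i \<in> V' \<Longrightarrow> j \<in> V' \<Longrightarrow> i \<notin> V \<or> j \<notin> V \<Longrightarrow> M i j = 0"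
  shows "bform V' M x y = bform V M x y"
proof -
  have "bform V' M x y = (\<Sum>i\<in>V. \<Sum>j\<in>V'. M i j * x i * y j)"
    unfolding bform_def using assms by (intro sum.mono_neutral_right) auto
  also have "\<dots> = bform V M x y"
    unfolding bform_def using assms by (intro sum.cong refl sum.mono_neutral_right) auto
  finally show ?thesis .
qed

lemma lorentzian_superset:
  assumes "finite V'" "V \<subseteq> V'"
    "\<And>i j. i \<in> V' \<Longrightarrow> j \<in> V' \<Longrightarrow> i \<notin> V \<or> j \<notin> V \<Longrightarrow> M i j = 0"
    "lorentzian V M"
  shows "lorentzian V' M"
proof -
  have "bform V' M = bform V M"
    using assms by (intro ext bform_superset) auto
  then show ?thesis using assms(4) by (simp add: lorentzian_def)
qed

lemma lorentzian_cong:
  assumes "\<And>i j. i \<in> V \<Longrightarrow> j \<in> V \<Longrightarrow> M i j = N i j"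
  shows "lorentzian V M \<longleftrightarrow> lorentzian V N"
proof -
  have "bform V M = bform V N"
    using assms by (intro ext) (simp add: bform_def)
  then show ?thesis by (simp add: lorentzian_def)
qed

lemma lorentzian_scale:
  assumes "0 \<le> c" "lorentzian V M"
  shows "lorentzian V (\<lambda>i j. c * M i j)"
proof -
  have eq: "bform V (\<lambda>i j. c * M i j) x y = c * bform V M x y" for x y
    by (simp add: bform_def sum_distrib_left mult_ac)
  show ?thesis
    unfolding lorentzian_def eq
  proof (intro allI impI)
    fix x y assume "0 < c * bform V M y y"
    then have "0 < bform V M y y" using assms(1) by (simp add: zero_less_mult_iff)
    then have "bform V M x x * bform V M y y \<le> (bform V M x y)\<^sup>2"
      using assms(2) by (simp add: lorentzian_def)
    then have "c\<^sup>2 * (bform V M x x * bform V M y y) \<le> c\<^sup>2 * (bform V M x y)\<^sup>2"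
      by (intro mult_left_mono) auto
    then show "c * bform V M x x * (c * bform V M y y) \<le> (c * bform V M x y)\<^sup>2"
      by (simp add: power2_eq_square mult_ac)
  qed
qed

lemma lorentzian_zero: "lorentzian V (\<lambda>i j. 0)"
  by (simp add: lorentzian_def bform_def)

lemma bform_nonneg:
  assumes "\<And>i j. i \<in> V \<Longrightarrow> j \<in> V \<Longrightarrow> 0 \<le> M i j" "\<And>i. i \<in> V \<Longrightarrow> 0 \<le> x i" "\<And>i. i \<in> V \<Longrightarrow> 0 \<le> y i"
  shows "0 \<le> bform V M x y"
  unfolding bform_def using assms by (intro sum_nonneg mult_nonneg_nonneg) auto

lemma lorentzian_entries:
  assumes "finite V" "lorentzian V M" "i \<in> V" "j \<in> V" "0 \<le> M i i" "0 \<le> M j j"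
  shows "M i i * M j j \<le> (M i j)\<^sup>2"
proof -
  have ind: "bform V M (\<lambda>k. if k = a then 1 else 0) (\<lambda>k. if k = b then 1 else 0) = M a b"
    if "a \<in> V" "b \<in> V" for a b
  proof -
    have "bform V M (\<lambda>k. if k = a then 1 else 0) (\<lambda>k. if k = b then 1 else 0)
        = (\<Sum>i\<in>V. if i = a then (\<Sum>j\<in>V. if j = b then M i j else 0) else 0)"
      unfolding bform_def by (intro sum.cong refl) (auto intro!: sum.cong sum.neutral)
    then show ?thesis using that assms(1) by simp
  qed
  show ?thesis
  proof (cases "M j j = 0")
    case False
    with assms have "0 < M j j" by simp
    with assms(2) ind[OF assms(4,4)] ind[OF assms(3,3)] ind[OF assms(3,4)] show ?thesis
      unfolding lorentzian_def by metis
  qed simp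
qed

section \<open>Rayleigh quotients and Perron--Frobenius\<close>

lemma rayleigh_maximizer:
  fixes M :: "'v \<Rightarrow> 'v \<Rightarrow> real"
  assumes fin: "finite V" and w: "\<And>i. i \<in> V \<Longrightarrow> 0 < w i"
    and x: "(\<Sum>i\<in>V. p i * x i) = 0" "0 < bform V M x x"
  obtains x0 \<mu> where "0 < \<mu>" "(\<Sum>i\<in>V. p i * x0 i) = 0" "0 < bform V M x0 x0"
    "bform V M x0 x0 = \<mu> * (\<Sum>i\<in>V. w i * (x0 i)\<^sup>2)"
    "\<And>u. (\<Sum>i\<in>V. p i * u i) = 0 \<Longrightarrow> bform V M u u \<le> \<mu> * (\<Sum>i\<in>V. w i * (u i)\<^sup>2)"
proof -
  \<comment> \<open>A maximizer of the Rayleigh quotient on the hyperplane orthogonal to p replaces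
    an eigenvector of M relative to diag w. The quotient is homogeneous of degree 0, so it suffices
    to maximize over the unit sphere.\<close>
  define W where "W = (\<lambda>u. \<Sum>i\<in>V. w i * (u i)\<^sup>2)"
  define f where "f = (\<lambda>u. bform V M u u / W u)"
  \<comment> \<open>Coordinates outside V are pinned to 0: B is then a product of intervals and
    points, compact by Tychonoff even when the index type is infinite.\<close>
  define B where "B = Pi\<^sub>E UNIV (\<lambda>i. if i \<in> V then {-1..1} else {0::real})"
  define S where "S = B \<inter> {u. (\<Sum>i\<in>V. (u i)\<^sup>2) = 1 \<and> (\<Sum>i\<in>V. p i * u i) = 0}"
  have "compactin (product_topology (\<lambda>i. euclidean) UNIV) B"
    unfolding B_def by (subst compactin_PiE) auto
  then have "compact B"
    by (simp add: euclidean_product_topology)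
  moreover have "closed {u. (\<Sum>i\<in>V. (u i)\<^sup>2) = 1 \<and> (\<Sum>i\<in>V. p i * u i) = (0::real)}"
    by (intro closed_Collect_conj closed_Collect_eq continuous_intros
        continuous_on_product_coordinates)
  ultimately have "compact S"
    unfolding S_def by (rule compact_Int_closed)
  have Wpos: "0 < W u" if "u i \<noteq> 0" "i \<in> V" for u i
  proof -
    have "0 < w i * (u i)\<^sup>2" using that w by simp
    also have "\<dots> \<le> W u"
      unfolding W_def using that fin w by (intro member_le_sum) (auto simp: less_imp_le)
    finally show ?thesis .
  qed
  have normalize: "\<exists>c>0. (\<lambda>i. c * (if i \<in> V then u i else 0)) \<in> S"
    if u: "(\<Sum>i\<in>V. p i * u i) = 0" and i: "i \<in> V" "u i \<noteq> 0" for u i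
  proof -
    let ?n = "\<Sum>i\<in>V. (u i)\<^sup>2"
    have le: "(u j)\<^sup>2 \<le> ?n" if "j \<in> V" for j
      using that fin by (intro member_le_sum) auto
    have n: "0 < ?n" using le[OF i(1)] i(2) by (smt (verit) zero_less_power2)
    define c where "c = 1 / sqrt ?n"
    have c: "0 < c" "c\<^sup>2 * ?n = 1" using n by (auto simp: c_def power_divide)
    have "\<bar>c * u j\<bar> \<le> 1" if "j \<in> V" for j
    proof -
      have "(c * u j)\<^sup>2 \<le> c\<^sup>2 * ?n"
        using le[OF that] by (simp add: power_mult_distrib mult_left_mono)
      then show ?thesis using c(2) by (simp add: abs_square_le_1)
    qed
    then have "(\<lambda>i. c * (if i \<in> V then u i else 0)) \<in> B"
      by (auto simp: B_def abs_le_iff)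
    moreover have "(\<Sum>i\<in>V. (c * (if i \<in> V then u i else 0))\<^sup>2) = c\<^sup>2 * ?n"
      by (simp add: sum_distrib_left power_mult_distrib)
    moreover have "(\<Sum>i\<in>V. p i * (c * (if i \<in> V then u i else 0))) = c * (\<Sum>i\<in>V. p i * u i)"
      by (simp add: sum_distrib_left mult_ac)
    ultimately show ?thesis using c u by (intro exI[of _ c]) (simp add: S_def)
  qed
  have bform_V: "bform V M (\<lambda>i. c * (if i \<in> V then u i else 0)) (\<lambda>i. c * (if i \<in> V then u i else 0))
      = c\<^sup>2 * bform V M u u" for c u
    by (simp add: bform_def sum_distrib_left power2_eq_square mult_ac)
  have W_V: "W (\<lambda>i. c * (if i \<in> V then u i else 0)) = c\<^sup>2 * W u" for c u
    by (simp add: W_def sum_distrib_left power_mult_distrib mult_ac)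
  have S_pos: "0 < W u" if "u \<in> S" for u
  proof -
    have "(\<Sum>i\<in>V. (u i)\<^sup>2) = 1" using that by (simp add: S_def)
    then obtain i where "i \<in> V" "u i \<noteq> 0"
      by (metis (no_types, lifting) power_zero_numeral sum.neutral zero_neq_one)
    then show ?thesis by (intro Wpos)
  qed
  have "\<exists>i\<in>V. x i \<noteq> 0"
    using x(2) by (rule contrapos_pp) (simp add: bform_def)
  then obtain i where i: "i \<in> V" "x i \<noteq> 0" by blast
  from normalize[OF x(1) i] obtain c where c: "c > 0" "(\<lambda>i. c * (if i \<in> V then x i else 0)) \<in> S"
    by blast
  have "continuous_on S f"
    unfolding f_def W_def bform_def
    using S_pos by (intro continuous_intros continuous_on_product_coordinates
        continuous_on_subset[OF continuous_on_product_coordinates]) (auto simp: W_def dest!: S_pos)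
  then obtain x0 where x0: "x0 \<in> S" "\<And>u. u \<in> S \<Longrightarrow> f u \<le> f x0"
    using continuous_attains_sup[OF \<open>compact S\<close>, of f] c(2) by blast
  have max: "bform V M u u \<le> f x0 * W u" if "(\<Sum>i\<in>V. p i * u i) = 0" for u
  proof (cases "\<exists>i\<in>V. u i \<noteq> 0")
    case True
    then obtain i where i: "i \<in> V" "u i \<noteq> 0" by blast
    from normalize[OF that i] obtain c where c: "c > 0" "(\<lambda>i. c * (if i \<in> V then u i else 0)) \<in> S"
      by blast
    from x0(2)[OF c(2)] have "bform V M u u / W u \<le> f x0"
      unfolding f_def bform_V W_V using c(1) by (simp add: f_def)
    then show ?thesis using Wpos[of u i, OF i(2,1)] by (simp add: pos_divide_le_eq)
  next
    case False
    then show ?thesis by (simp add: bform_def W_def)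
  qed
  have "0 < f x0 * W x" using max[OF x(1)] x(2) by linarith
  then have pos: "0 < f x0" using Wpos[of x i, OF i(2,1)] by (simp add: zero_less_mult_iff)
  have val: "bform V M x0 x0 = f x0 * W x0"
    using S_pos[OF x0(1)] by (simp add: f_def)
  show thesis
  proof (rule that[of "f x0" x0])
    show "(\<Sum>i\<in>V. p i * x0 i) = 0" using x0(1) by (simp add: S_def)
    show "0 < bform V M x0 x0" using val pos S_pos[OF x0(1)] by simp
  qed (use pos val max in \<open>simp_all add: W_def\<close>)
qed

text \<open>For small t of sign opposite to b the linear term outweighs the quadratic one. This is
  the stationarity condition at a maximizer, obtained without calculus.\<close>

lemma linear_term_zero:
  fixes b c :: real
  assumes "\<And>t. 0 \<le> 2 * t * b + t\<^sup>2 * c"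
  shows "b = 0"
proof (rule ccontr)
  assume b: "b \<noteq> 0"
  define d where "d = \<bar>c\<bar> + 1"
  have d: "d > 0" "c < d" by (auto simp: d_def)
  have "0 \<le> 2 * (- b / d) * b + (- b / d)\<^sup>2 * c" by (rule assms)
  also have "\<dots> = b\<^sup>2 / d\<^sup>2 * (c - 2 * d)" using d
    by (simp add: field_simps power2_eq_square)
  also have "\<dots> < 0" using b d by (intro mult_pos_neg) auto
  finally show False by simp
qed

text \<open>The Bochner-type inequality \<open>bochner\<close> forces every positive eigenvalue of \<open>diag (v / M v) M\<close>
  to be at least \<open>1\<close>, while Perron--Frobenius bounds them by \<open>1\<close>, with equality only along \<open>v\<close>.\<close>

lemma nonpos_on_perp_of_bochner:
  fixes M :: "'v \<Rightarrow> 'v \<Rightarrow> real"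
  assumes fin: "finite V"
    and sym: "\<And>i j. M i j = M j i" and nonneg: "\<And>i j. 0 \<le> M i j"
    and v: "\<And>i. i \<in> V \<Longrightarrow> 0 < v i"
    and p: "\<And>i. p i = (\<Sum>j\<in>V. M i j * v j)"
    and conn: "\<And>i j. i \<in> V \<Longrightarrow> j \<in> V \<Longrightarrow> 0 < p i \<Longrightarrow> 0 < p j \<Longrightarrow>
                 (i, j) \<in> {(i, j). i \<in> V \<and> j \<in> V \<and> 0 < M i j}\<^sup>*"
    and bochner: "\<And>x. bform V M x x \<le> (\<Sum>i\<in>V. v i * (\<Sum>j\<in>V. M i j * x j)\<^sup>2 / p i)"
    and perp: "bform V M x v = 0"
  shows "bform V M x x \<le> 0"
proof (rule ccontr)
  assume "\<not> bform V M x x \<le> 0"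
  then have x: "0 < bform V M x x" by simp
  \<comment> \<open>On rows with p i > 0 this weight makes v an eigenvector of eigenvalue 1, since p
    i = w i * v i. A row with p i = 0 vanishes on V; the value 1 there keeps the weighted norm
    positive definite.\<close>
  define w where "w = (\<lambda>i. if p i > 0 then p i / v i else 1)"
  have p0: "0 \<le> p i" for i
    unfolding p using nonneg v by (intro sum_nonneg mult_nonneg_nonneg) (auto simp: less_imp_le)
  have w: "0 < w i" if "i \<in> V" for i using v[OF that] by (simp add: w_def)
  have Mzero: "M i j = 0" if "p i = 0" "j \<in> V" for i j
  proof -
    have "\<forall>j\<in>V. M i j * v j = 0"
      using that(1) fin nonneg v unfolding p
      by (subst (asm) sum_nonneg_eq_0_iff) (auto simp: less_imp_le)
    then show ?thesis using that(2) v by fastforce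
  qed
  have perp_eq: "bform V M y v = (\<Sum>i\<in>V. p i * y i)" for y
    by (simp add: bform_rows p mult_ac)
  obtain x0 \<mu> where x0: "0 < \<mu>" "(\<Sum>i\<in>V. p i * x0 i) = 0" "0 < bform V M x0 x0"
    "bform V M x0 x0 = \<mu> * (\<Sum>i\<in>V. w i * (x0 i)\<^sup>2)"
    "\<And>u. (\<Sum>i\<in>V. p i * u i) = 0 \<Longrightarrow> bform V M u u \<le> \<mu> * (\<Sum>i\<in>V. w i * (u i)\<^sup>2)"
    by (rule rayleigh_maximizer[of V w p x M, OF fin w perp[unfolded perp_eq] x]) blast+
  \<comment> \<open>The image of x0 under diag (1 / w) M. Stationarity is tested in this single
    direction: the left side of \<open>crit\<close> becomes the right side of
    \<open>bochner\<close>, and its right side becomes \<mu> times the form at x0, whence \<mu>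
    \<ge> 1.\<close>
  define r where "r = (\<lambda>i. (\<Sum>j\<in>V. M i j * x0 j) / w i)"
  have row0: "(\<Sum>j\<in>V. M i j * x0 j) = 0" if "p i = 0" for i
    using Mzero[OF that] by simp
  have pr: "p i * r i = v i * (\<Sum>j\<in>V. M i j * x0 j)" if "i \<in> V" for i
    using v[OF that] p0[of i] row0[of i] by (auto simp: r_def w_def)
  have r_perp: "(\<Sum>i\<in>V. p i * r i) = 0"
  proof -
    have "(\<Sum>i\<in>V. p i * r i) = bform V M v x0"
      by (simp add: pr bform_rows)
    also have "\<dots> = bform V M x0 v" by (rule bform_commute[OF sym])
    finally show ?thesis using x0(2) by (simp add: perp_eq)
  qed
  have "0 \<le> 2 * t * (\<mu> * (\<Sum>i\<in>V. w i * x0 i * r i) - bform V M x0 r)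
      + t\<^sup>2 * (\<mu> * (\<Sum>i\<in>V. w i * (r i)\<^sup>2) - bform V M r r)" for t
  proof -
    have "(\<Sum>i\<in>V. p i * (1 * x0 i + t * r i)) = (\<Sum>i\<in>V. p i * x0 i) + t * (\<Sum>i\<in>V. p i * r i)"
      by (simp add: sum.distrib sum_distrib_left algebra_simps)
    then have "(\<Sum>i\<in>V. p i * (1 * x0 i + t * r i)) = 0" using x0(2) r_perp by simp
    from x0(5)[OF this]
    have "bform V M x0 x0 + 2 * t * bform V M x0 r + t\<^sup>2 * bform V M r r
       \<le> \<mu> * (\<Sum>i\<in>V. w i * (1 * x0 i + t * r i)\<^sup>2)"
      unfolding bform_combination[OF sym] by simp
    also have "(\<Sum>i\<in>V. w i * (1 * x0 i + t * r i)\<^sup>2)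
        = (\<Sum>i\<in>V. w i * (x0 i)\<^sup>2) + 2 * t * (\<Sum>i\<in>V. w i * x0 i * r i) + t\<^sup>2 * (\<Sum>i\<in>V. w i * (r i)\<^sup>2)"
      by (simp add: sum.distrib sum_distrib_left power2_eq_square algebra_simps)
    finally show ?thesis using x0(4) by (simp add: algebra_simps)
  qed
  then have crit: "bform V M x0 r = \<mu> * (\<Sum>i\<in>V. w i * x0 i * r i)"
    by (drule_tac linear_term_zero) simp
  have "(\<Sum>i\<in>V. w i * x0 i * r i) = bform V M x0 x0"
    unfolding bform_rows
  proof (intro sum.cong refl)
    fix i assume "i \<in> V"
    then show "w i * x0 i * r i = x0 i * (\<Sum>j\<in>V. M i j * x0 j)"
      using w[of i] by (simp add: r_def)
  qed
  moreover have "bform V M x0 r = (\<Sum>i\<in>V. v i * (\<Sum>j\<in>V. M i j * x0 j)\<^sup>2 / p i)"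
  proof -
    have "bform V M x0 r = bform V M r x0" by (rule bform_commute[OF sym])
    also have "\<dots> = (\<Sum>i\<in>V. v i * (\<Sum>j\<in>V. M i j * x0 j)\<^sup>2 / p i)"
      unfolding bform_rows
    proof (intro sum.cong refl)
      fix i assume "i \<in> V"
      then show "r i * (\<Sum>j\<in>V. M i j * x0 j) = v i * (\<Sum>j\<in>V. M i j * x0 j)\<^sup>2 / p i"
        using v[of i] p0[of i] row0[of i]
        by (cases "p i = 0") (simp_all add: r_def w_def power2_eq_square)
    qed
    finally show ?thesis .
  qed
  ultimately have "bform V M x0 x0 \<le> \<mu> * bform V M x0 x0"
    using bochner[of x0] crit by simp
  then have "1 \<le> \<mu>" using x0(3) by simp
  have "0 \<le> (\<Sum>i\<in>V. w i * (x0 i)\<^sup>2)"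
    using w by (intro sum_nonneg mult_nonneg_nonneg) (auto simp: less_imp_le)
  from mult_right_mono[OF \<open>1 \<le> \<mu>\<close> this] have Wle: "(\<Sum>i\<in>V. w i * (x0 i)\<^sup>2) \<le> bform V M x0 x0"
    unfolding x0(4) by simp
  \<comment> \<open>Ground state substitution by v: the total of D is twice the difference of \<Sum>
    p x0^2 / v and the form at x0. By \<open>Wle\<close> it is nonpositive, so every term vanishes
    and x0 / v is constant along the edges of M.\<close>
  define D where "D = (\<lambda>i j. M i j * v i * v j * (x0 i / v i - x0 j / v j)\<^sup>2)"
  have D0: "0 \<le> D i j" if "i \<in> V" "j \<in> V" for i j
    using that v nonneg by (auto simp: D_def simp: less_imp_le)
  have Dexp: "D i j = M i j * v j * ((x0 i)\<^sup>2 / v i) + M i j * v i * ((x0 j)\<^sup>2 / v j)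
      - 2 * (M i j * x0 i * x0 j)" if "i \<in> V" "j \<in> V" for i j
    using v[OF that(1)] v[OF that(2)] by (simp add: D_def field_simps power2_eq_square)
  have diag: "(\<Sum>i\<in>V. \<Sum>j\<in>V. M i j * v j * ((x0 i)\<^sup>2 / v i)) = (\<Sum>i\<in>V. p i * ((x0 i)\<^sup>2 / v i))"
    unfolding p by (simp only: sum_distrib_right)
  have diag': "(\<Sum>i\<in>V. \<Sum>j\<in>V. M i j * v i * ((x0 j)\<^sup>2 / v j)) = (\<Sum>i\<in>V. p i * ((x0 i)\<^sup>2 / v i))"
    unfolding diag[symmetric] by (subst sum.swap) (intro sum.cong refl arg_cong2[where f = "(*)"] sym)
  have "(\<Sum>i\<in>V. \<Sum>j\<in>V. D i j)
      = (\<Sum>i\<in>V. \<Sum>j\<in>V. M i j * v j * ((x0 i)\<^sup>2 / v i) + M i j * v i * ((x0 j)\<^sup>2 / v j)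
          - 2 * (M i j * x0 i * x0 j))"
    by (intro sum.cong refl Dexp)
  also have "\<dots> = 2 * (\<Sum>i\<in>V. p i * ((x0 i)\<^sup>2 / v i)) - 2 * bform V M x0 x0"
    by (simp only: sum.distrib sum_subtractf diag diag' bform_def flip: sum_distrib_left)
  also have "\<dots> \<le> 2 * (\<Sum>i\<in>V. w i * (x0 i)\<^sup>2) - 2 * bform V M x0 x0"
  proof -
    have "p i * ((x0 i)\<^sup>2 / v i) \<le> w i * (x0 i)\<^sup>2" for i
      using p0[of i] by (cases "p i = 0") (simp_all add: w_def)
    then show ?thesis by (intro diff_right_mono mult_left_mono sum_mono) auto
  qed
  also have "\<dots> \<le> 0" using Wle by simp
  finally have "(\<Sum>i\<in>V. \<Sum>j\<in>V. D i j) \<le> 0" .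
  moreover have Dsum: "0 \<le> (\<Sum>j\<in>V. D i j)" if "i \<in> V" for i using D0 that by (intro sum_nonneg) auto
  moreover have "D i j \<le> (\<Sum>i\<in>V. \<Sum>j\<in>V. D i j)" if "i \<in> V" "j \<in> V" for i j
  proof -
    have "D i j \<le> (\<Sum>j\<in>V. D i j)" using that D0 fin by (intro member_le_sum) auto
    also have "\<dots> \<le> (\<Sum>i\<in>V. \<Sum>j\<in>V. D i j)"
      using that Dsum fin by (intro member_le_sum[where f = "\<lambda>i. \<Sum>j\<in>V. D i j"]) auto
    finally show ?thesis .
  qed
  ultimately have Dz: "D i j = 0" if "i \<in> V" "j \<in> V" for i j
    using D0 that by (meson order.antisym order_trans)
  have step: "x0 i / v i = x0 j / v j" if "i \<in> V" "j \<in> V" "0 < M i j" for i j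
    using Dz[OF that(1,2)] v[OF that(1)] v[OF that(2)] that(3) by (simp add: D_def)
  have path: "x0 i / v i = x0 j / v j" if "(i, j) \<in> {(i, j). i \<in> V \<and> j \<in> V \<and> 0 < M i j}\<^sup>*" for i j
    using that by induction (use step in auto)
  have "\<exists>i\<in>V. 0 < p i"
  proof (rule ccontr)
    assume "\<not> ?thesis"
    then have "p i = 0" if "i \<in> V" for i using that p0[of i] by fastforce
    then show False using x0(3) Mzero by (simp add: bform_def)
  qed
  then obtain k where k: "k \<in> V" "0 < p k" by blast
  \<comment> \<open>By connectedness x0 = c v wherever p > 0; orthogonality to p then gives c =
    0.\<close>
  define c where "c = x0 k / v k"
  have xc: "x0 i = c * v i" if "i \<in> V" "0 < p i" for i
    using path[OF conn[OF that(1) k(1) that(2) k(2)]] v[OF that(1)] by (simp add: c_def field_simps)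
  have "(\<Sum>i\<in>V. p i * x0 i) = c * (\<Sum>i\<in>V. p i * v i)"
    unfolding sum_distrib_left
  proof (intro sum.cong refl)
    fix i assume "i \<in> V"
    then show "p i * x0 i = c * (p i * v i)" using xc[of i] p0[of i] by (cases "p i = 0") auto
  qed
  moreover have "0 < (\<Sum>i\<in>V. p i * v i)"
    using k fin p0 v by (intro sum_pos2[of V k]) (auto simp: less_imp_le)
  ultimately have "c = 0" using x0(2) by simp
  then have "M i j * x0 i * x0 j = 0" if "i \<in> V" "j \<in> V" for i j
    using xc[OF that(1)] Mzero[OF _ that(2), of i] p0[of i] by (cases "p i = 0") auto
  then have "bform V M x0 x0 = 0" unfolding bform_def by (intro sum.neutral ballI)
  then show False using x0(3) by simp
qed

subsection \<open>The local-to-global principle\<close>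

text \<open>A polynomial is encoded by the values at \<open>0\<close> of its partial derivatives, a function \<open>c\<close> of the
  multiset of the differentiation variables; \<open>derivs V vs c \<alpha>\<close> is then the derivative along the vectors
  \<open>vs\<close> and the variables \<open>\<alpha>\<close>.\<close>

primrec derivs :: "'v set \<Rightarrow> ('v \<Rightarrow> real) list \<Rightarrow> ('v multiset \<Rightarrow> real) \<Rightarrow> 'v multiset \<Rightarrow> real" where
  "derivs V [] c \<alpha> = c \<alpha>"
| "derivs V (v # vs) c \<alpha> = (\<Sum>i\<in>V. v i * derivs V vs c (add_mset i \<alpha>))"

lemma derivs_shift: "derivs V vs (\<lambda>\<alpha>. c (add_mset i \<alpha>)) \<alpha> = derivs V vs c (add_mset i \<alpha>)"
proof (induction vs arbitrary: \<alpha>)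
  case (Cons v vs)
  show ?case
    unfolding derivs.simps Cons.IH by (subst add_mset_commute) (rule refl)
qed simp

lemma derivs_nonneg:
  assumes "\<And>\<alpha>. 0 \<le> c \<alpha>" "\<And>v i. v \<in> set vs \<Longrightarrow> i \<in> V \<Longrightarrow> 0 \<le> v i"
  shows "0 \<le> derivs V vs c \<alpha>"
  using assms(2)
  by (induction vs arbitrary: \<alpha>) (auto intro!: sum_nonneg mult_nonneg_nonneg assms(1))

text \<open>Strictly positive directions give every monomial a positive weight, so one positive term
  suffices. With \<open>derivs_nonzero_imp\<close> this makes the support of a mixed derivative
  independent of the directions.\<close>

lemma derivs_pos:
  assumes "finite V" "\<And>\<alpha>. 0 \<le> c \<alpha>" "\<And>v i. v \<in> set vs \<Longrightarrow> i \<in> V \<Longrightarrow> 0 < v i"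
    and "size \<beta> = length vs" "set_mset \<beta> \<subseteq> V" "0 < c (\<beta> + \<alpha>)"
  shows "0 < derivs V vs c \<alpha>"
  using assms(3-)
proof (induction vs arbitrary: \<alpha> \<beta>)
  case (Cons v vs)
  from Cons.prems(2) obtain i \<gamma> where \<beta>: "\<beta> = add_mset i \<gamma>"
    using size_eq_Suc_imp_eq_union[of \<beta> "length vs"] by auto
  have "0 < derivs V vs c (add_mset i \<alpha>)"
    using Cons.prems unfolding \<beta> by (intro Cons.IH[of \<gamma>]) auto
  then have "0 < v i * derivs V vs c (add_mset i \<alpha>)"
    using Cons.prems(1)[of v i] Cons.prems(3) unfolding \<beta> by simp
  moreover have "0 \<le> v j * derivs V vs c (add_mset j \<alpha>)" if "j \<in> V" for j
    using Cons.prems that assms(2)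
    by (intro mult_nonneg_nonneg derivs_nonneg) (auto simp: less_imp_le)
  moreover have "i \<in> V" using Cons.prems(3) unfolding \<beta> by simp
  ultimately show ?case
    unfolding derivs.simps using assms(1) by (intro sum_pos2[of V i]) auto
qed simp

lemma derivs_nonzero_imp:
  assumes "derivs V vs c \<alpha> \<noteq> 0"
  obtains \<beta> where "size \<beta> = length vs" "set_mset \<beta> \<subseteq> V" "c (\<beta> + \<alpha>) \<noteq> 0"
proof -
  have "\<exists>\<beta>. size \<beta> = length vs \<and> set_mset \<beta> \<subseteq> V \<and> c (\<beta> + \<alpha>) \<noteq> 0"
    using assms
  proof (induction vs arbitrary: \<alpha>)
    case (Cons v vs)
    from Cons.prems obtain i where i: "i \<in> V" "v i * derivs V vs c (add_mset i \<alpha>) \<noteq> 0"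
      unfolding derivs.simps by (rule sum.not_neutral_contains_not_neutral)
    then have "derivs V vs c (add_mset i \<alpha>) \<noteq> 0" by auto
    from Cons.IH[OF this] obtain \<beta> where
      "size \<beta> = length vs" "set_mset \<beta> \<subseteq> V" "c (\<beta> + add_mset i \<alpha>) \<noteq> 0" by blast
    then show ?case using i(1) by (intro exI[of _ "add_mset i \<beta>"]) simp
  qed (auto intro: exI[of _ "{#}"])
  with that show thesis by blast
qed


lemma tendsto_derivs:
  assumes "\<And>v i. v \<in> set vs \<Longrightarrow> ((\<lambda>\<epsilon>. f \<epsilon> v i) \<longlongrightarrow> v i) F"
  shows "((\<lambda>\<epsilon>. derivs V (map (f \<epsilon>) vs) c \<alpha>) \<longlongrightarrow> derivs V vs c \<alpha>) F"
  using assms by (induction vs arbitrary: \<alpha>) (auto intro!: tendsto_intros)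

text \<open>Support graph of the second-order derivatives of \<open>c\<close> that remain after differentiating by \<open>\<alpha>\<close>; its
  connectedness gives the irreducibility needed for Perron--Frobenius.\<close>

definition linked :: "'v set \<Rightarrow> nat \<Rightarrow> ('v multiset \<Rightarrow> real) \<Rightarrow> 'v multiset \<Rightarrow> ('v \<times> 'v) set" where
  "linked V m c \<alpha> = {(i, j). i \<in> V \<and> j \<in> V \<and>
     (\<exists>\<beta>. size \<beta> + size \<alpha> = m \<and> set_mset \<beta> \<subseteq> V \<and> 0 < c (\<beta> + \<alpha> + {#i, j#}))}"

text \<open>Induction on the directions. Replacing the first direction v by a coordinate k gives
  matrices N k that are Lorentzian by induction, because
  \<open>\<lambda>\<alpha>. c (add_mset k \<alpha>)\<close> inherits the hypotheses. Reversed
  Cauchy--Schwarz for N k at v, weighted by v k and summed over k, is the Bochner inequality for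
  M.\<close>

lemma lorentzian_local_to_global_pos:
  fixes c :: "'v multiset \<Rightarrow> real"
  assumes fin: "finite V"
    and "\<And>\<alpha>. 0 \<le> c \<alpha>"
    and "\<And>\<alpha>. size \<alpha> = m \<Longrightarrow> set_mset \<alpha> \<subseteq> V \<Longrightarrow> lorentzian V (\<lambda>i j. c (\<alpha> + {#i, j#}))"
    and "\<And>\<alpha> i j. size \<alpha> < m \<Longrightarrow> set_mset \<alpha> \<subseteq> V \<Longrightarrow> i \<in> Domain (linked V m c \<alpha>) \<Longrightarrow>
           j \<in> Domain (linked V m c \<alpha>) \<Longrightarrow> (i, j) \<in> (linked V m c \<alpha>)\<^sup>*"
    and "length vs = m" "\<And>v i. v \<in> set vs \<Longrightarrow> i \<in> V \<Longrightarrow> 0 < v i"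
  shows "lorentzian V (\<lambda>i j. derivs V vs c {#i, j#})"
  using assms(2-)
proof (induction vs arbitrary: m c)
  case Nil
  then show ?case using Nil.prems(2)[of "{#}"] by simp
next
  case (Cons v vs)
  note nonneg = Cons.prems(1) and quad = Cons.prems(2) and conn = Cons.prems(3)
    and len = Cons.prems(4) and pos = Cons.prems(5)
  obtain m' where m: "m = Suc m'" "length vs = m'" using len by auto
  define M where "M = (\<lambda>i j. derivs V (v # vs) c {#i, j#})"
  define N where "N = (\<lambda>k i j. derivs V vs c {#k, i, j#})"
  define p where "p = (\<lambda>i. \<Sum>j\<in>V. M i j * v j)"
  have v: "0 < v i" if "i \<in> V" for i using pos that by simp
  have MN: "M i j = (\<Sum>k\<in>V. v k * N k i j)" for i j by (simp add: M_def N_def)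
  \<comment> \<open>Mixed derivatives commute, so row i of M is N i applied to v, and p i is the
    form of N i at v. This is what expresses the right side of the Bochner inequality through the N
    k.\<close>
  have N_rot: "N k i j = N i k j" for i j k by (simp add: N_def add_mset_commute)
  have M_sym: "M i j = M j i" for i j by (simp add: M_def add_mset_commute)
  have N_nonneg: "0 \<le> N k i j" for k i j
    unfolding N_def using nonneg pos by (intro derivs_nonneg) (auto simp: less_imp_le)
  have M_nonneg: "0 \<le> M i j" for i j
    unfolding M_def using nonneg pos by (intro derivs_nonneg) (auto simp: less_imp_le)
  have M_row: "(\<Sum>j\<in>V. M i j * x j) = bform V (N i) v x" for i x
  proof -
    have "(\<Sum>j\<in>V. M i j * x j) = (\<Sum>j\<in>V. \<Sum>k\<in>V. N i k j * v k * x j)"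
      unfolding MN sum_distrib_right by (intro sum.cong refl) (subst N_rot, simp)
    also have "\<dots> = bform V (N i) v x" unfolding bform_def by (rule sum.swap)
    finally show ?thesis .
  qed
  have p_eq: "p i = bform V (N i) v v" for i by (simp add: p_def M_row)
  have N_lor: "lorentzian V (N k)" if k: "k \<in> V" for k
  proof -
    have linked_eq: "linked V m' (\<lambda>\<alpha>. c (add_mset k \<alpha>)) \<alpha> = linked V m c (add_mset k \<alpha>)" for \<alpha>
    proof -
      have "\<beta> + add_mset k \<alpha> + {#i, j#} = add_mset k (\<beta> + \<alpha> + {#i, j#})" for i j \<beta>
        by (simp add: add_mset_commute)
      then show ?thesis by (simp only: linked_def m(1) size_add_mset add_Suc_right nat.inject)
    qed
    have "lorentzian V (\<lambda>i j. derivs V vs (\<lambda>\<alpha>. c (add_mset k \<alpha>)) {#i, j#})"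
    proof (rule Cons.IH)
      fix \<alpha> :: "'v multiset" assume "size \<alpha> = m'" "set_mset \<alpha> \<subseteq> V"
      then show "lorentzian V (\<lambda>i j. c (add_mset k (\<alpha> + {#i, j#})))"
        using quad[of "add_mset k \<alpha>"] k by (simp add: m(1) del: union_mset_add_mset_right)
    next
      fix \<alpha> i j
      assume "size \<alpha> < m'" "set_mset \<alpha> \<subseteq> V"
        "i \<in> Domain (linked V m' (\<lambda>\<alpha>. c (add_mset k \<alpha>)) \<alpha>)"
        "j \<in> Domain (linked V m' (\<lambda>\<alpha>. c (add_mset k \<alpha>)) \<alpha>)"
      then show "(i, j) \<in> (linked V m' (\<lambda>\<alpha>. c (add_mset k \<alpha>)) \<alpha>)\<^sup>*"
        unfolding linked_eq using k by (intro conn) (auto simp: m)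
    qed (use nonneg m pos in auto)
    then show ?thesis by (simp add: derivs_shift N_def)
  qed
  \<comment> \<open>All directions are strictly positive on V, so the edges of M are those of the
    support graph at the empty multiset, where \<open>conn\<close> gives irreducibility.\<close>
  have edges: "{(i, j). i \<in> V \<and> j \<in> V \<and> 0 < M i j} = linked V m c {#}"
  proof -
    have "0 < M i j \<longleftrightarrow> (\<exists>\<beta>. size \<beta> = m \<and> set_mset \<beta> \<subseteq> V \<and> 0 < c (\<beta> + {#i, j#}))" for i j
    proof
      assume "0 < M i j"
      then have "derivs V (v # vs) c {#i, j#} \<noteq> 0" by (simp add: M_def)
      then obtain \<beta> where "size \<beta> = length (v # vs)" "set_mset \<beta> \<subseteq> V" "c (\<beta> + {#i, j#}) \<noteq> 0"
        by (rule derivs_nonzero_imp)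
      then show "\<exists>\<beta>. size \<beta> = m \<and> set_mset \<beta> \<subseteq> V \<and> 0 < c (\<beta> + {#i, j#})"
        using len nonneg[of "\<beta> + {#i, j#}"] by (intro exI[of _ \<beta>]) auto
    next
      assume "\<exists>\<beta>. size \<beta> = m \<and> set_mset \<beta> \<subseteq> V \<and> 0 < c (\<beta> + {#i, j#})"
      then obtain \<beta> where "size \<beta> = m" "set_mset \<beta> \<subseteq> V" "0 < c (\<beta> + {#i, j#})" by blast
      then show "0 < M i j"
        unfolding M_def by (intro derivs_pos[where \<beta> = \<beta>]) (use fin nonneg pos len in auto)
    qed
    then show ?thesis by (auto simp: linked_def)
  qed
  have p_dom: "i \<in> Domain (linked V m c {#})" if i: "i \<in> V" "0 < p i" for i
  proof -
    obtain j where "j \<in> V" "M i j * v j \<noteq> 0"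
      using i(2) unfolding p_def
      by (metis (no_types, lifting) order_less_irrefl sum.not_neutral_contains_not_neutral)
    then have "(i, j) \<in> {(i, j). i \<in> V \<and> j \<in> V \<and> 0 < M i j}"
      using i(1) M_nonneg[of i j] by auto
    then show ?thesis unfolding edges by blast
  qed
  have bochner: "bform V M x x \<le> (\<Sum>i\<in>V. v i * (\<Sum>j\<in>V. M i j * x j)\<^sup>2 / p i)" for x
  proof -
    have le: "bform V (N k) x x \<le> (bform V (N k) v x)\<^sup>2 / p k" if k: "k \<in> V" for k
    proof (cases "p k = 0")
      \<comment> \<open>Positivity of v makes all entries of N k on V vanish, and division by 0
        gives 0, so the bound reads 0 \<le> 0.\<close>
      case True
      have "N k i j = 0" if "i \<in> V" "j \<in> V" for i j
      proof -
        have "(\<Sum>i\<in>V. \<Sum>j\<in>V. N k i j * v i * v j) = 0"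
          using True by (simp add: p_eq bform_def)
        moreover have nn: "0 \<le> N k i j * v i * v j" if "i \<in> V" "j \<in> V" for i j
          using that v N_nonneg by (simp add: less_imp_le)
        ultimately have "N k i j * v i * v j = 0"
          using that fin by (simp add: sum_nonneg_eq_0_iff sum_nonneg)
        then show ?thesis using v that by fastforce
      qed
      then have "bform V (N k) x x = 0" unfolding bform_def by (intro sum.neutral ballI) simp
      then show ?thesis using True by simp
    next
      case False
      moreover have "0 \<le> p k" unfolding p_eq using N_nonneg v
        by (intro bform_nonneg) (auto simp: less_imp_le)
      ultimately have pk: "0 < p k" by simp
      have "bform V (N k) x x * p k \<le> (bform V (N k) x v)\<^sup>2"
        using N_lor[OF k] pk unfolding lorentzian_def p_eq by blast
      moreover have "bform V (N k) x v = bform V (N k) v x"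
        by (rule bform_commute) (simp add: N_def add_mset_commute)
      ultimately show ?thesis using pk by (simp add: pos_le_divide_eq)
    qed
    have "bform V M x x = (\<Sum>i\<in>V. \<Sum>j\<in>V. \<Sum>k\<in>V. v k * (N k i j * x i * x j))"
      by (simp add: bform_def MN sum_distrib_left sum_distrib_right mult_ac)
    also have "\<dots> = (\<Sum>i\<in>V. \<Sum>k\<in>V. \<Sum>j\<in>V. v k * (N k i j * x i * x j))"
      by (rule sum.cong[OF refl], rule sum.swap)
    also have "\<dots> = (\<Sum>k\<in>V. \<Sum>i\<in>V. \<Sum>j\<in>V. v k * (N k i j * x i * x j))"
      by (rule sum.swap)
    also have "\<dots> = (\<Sum>k\<in>V. v k * bform V (N k) x x)"
      by (simp only: bform_def sum_distrib_left)
    also have "\<dots> \<le> (\<Sum>k\<in>V. v k * ((bform V (N k) v x)\<^sup>2 / p k))"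
      using le v by (intro sum_mono mult_left_mono) (auto simp: less_imp_le)
    finally show ?thesis by (simp add: M_row)
  qed
  have "lorentzian V M"
  proof (rule lorentzianI_nonpos_on_perp[where v = v])
    fix x assume "bform V M x v = 0"
    then show "bform V M x x \<le> 0"
    proof (rule nonpos_on_perp_of_bochner[where p = p, rotated -1])
      fix i j assume "i \<in> V" "j \<in> V" "0 < p i" "0 < p j"
      then show "(i, j) \<in> {(i, j). i \<in> V \<and> j \<in> V \<and> 0 < M i j}\<^sup>*"
        unfolding edges using m by (intro conn p_dom) auto
    qed (use fin M_sym M_nonneg v bochner p_def in auto)
  qed (rule M_sym)
  then show ?case by (simp only: M_def)
qed

text \<open>Directions on the boundary of the orthant are out of reach of the Perron--Frobenius
  argument. The inequality between entries is a closed condition, so it survives the limit of the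
  shifted directions v + \<epsilon>.\<close>

theorem lorentzian_local_to_global:
  fixes c :: "'v multiset \<Rightarrow> real"
  assumes fin: "finite V"
    and nonneg: "\<And>\<alpha>. 0 \<le> c \<alpha>"
    and quad: "\<And>\<alpha>. size \<alpha> = m \<Longrightarrow> set_mset \<alpha> \<subseteq> V \<Longrightarrow> lorentzian V (\<lambda>i j. c (\<alpha> + {#i, j#}))"
    and conn: "\<And>\<alpha> i j. size \<alpha> < m \<Longrightarrow> set_mset \<alpha> \<subseteq> V \<Longrightarrow> i \<in> Domain (linked V m c \<alpha>) \<Longrightarrow>
           j \<in> Domain (linked V m c \<alpha>) \<Longrightarrow> (i, j) \<in> (linked V m c \<alpha>)\<^sup>*"
    and vs: "length vs = m" "\<And>v i. v \<in> set vs \<Longrightarrow> i \<in> V \<Longrightarrow> 0 \<le> v i"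
    and ij: "i \<in> V" "j \<in> V"
  shows "derivs V vs c {#i, i#} * derivs V vs c {#j, j#} \<le> (derivs V vs c {#i, j#})\<^sup>2"
proof (rule tendsto_le)
  define ws where "ws = (\<lambda>\<epsilon>. map (\<lambda>v i. v i + \<epsilon>) vs)"
  have lim: "((\<lambda>\<epsilon>. derivs V (ws \<epsilon>) c \<alpha>) \<longlongrightarrow> derivs V vs c \<alpha>) (at_right 0)" for \<alpha>
    unfolding ws_def by (rule tendsto_derivs) (auto intro!: tendsto_eq_intros)
  show "((\<lambda>\<epsilon>. derivs V (ws \<epsilon>) c {#i, i#} * derivs V (ws \<epsilon>) c {#j, j#}) \<longlongrightarrow>
      derivs V vs c {#i, i#} * derivs V vs c {#j, j#}) (at_right 0)"
    by (intro tendsto_intros lim)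
  show "((\<lambda>\<epsilon>. (derivs V (ws \<epsilon>) c {#i, j#})\<^sup>2) \<longlongrightarrow> (derivs V vs c {#i, j#})\<^sup>2) (at_right 0)"
    by (intro tendsto_intros lim)
  have "derivs V (ws \<epsilon>) c {#i, i#} * derivs V (ws \<epsilon>) c {#j, j#} \<le> (derivs V (ws \<epsilon>) c {#i, j#})\<^sup>2"
    if "0 < \<epsilon>" for \<epsilon>
  proof -
    have ws_pos: "0 < w i" if "w \<in> set (ws \<epsilon>)" "i \<in> V" for w i
      using that vs(2) \<open>0 < \<epsilon>\<close> by (auto simp: ws_def add_nonneg_pos)
    have "lorentzian V (\<lambda>i j. derivs V (ws \<epsilon>) c {#i, j#})"
      using vs(1) by (intro lorentzian_local_to_global_pos[OF fin nonneg quad conn]) (auto simp: ws_def ws_pos[unfolded ws_def])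
    then show ?thesis
      using ws_pos nonneg by (rule_tac lorentzian_entries[OF fin _ ij])
        (auto intro!: derivs_nonneg simp: less_imp_le)
  qed
  then show "\<forall>\<^sub>F \<epsilon> in at_right 0. derivs V (ws \<epsilon>) c {#i, i#} * derivs V (ws \<epsilon>) c {#j, j#}
      \<le> (derivs V (ws \<epsilon>) c {#i, j#})\<^sup>2"
    by (auto simp: eventually_at_right_less intro: eventually_mono[OF eventually_at_right_less])
qed simp

subsection \<open>Ultrametric and four-point matrices\<close>

lemma bform_Un:
  assumes "finite C" "finite D" "C \<inter> D = {}"
  shows "bform (C \<union> D) M x y = bform C M x y + bform D M x y
    + (\<Sum>i\<in>C. \<Sum>j\<in>D. M i j * x i * y j) + (\<Sum>i\<in>D. \<Sum>j\<in>C. M i j * x i * y j)"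
  using assms by (simp add: bform_def sum.union_disjoint sum.distrib)

text \<open>Cauchy--Schwarz in quotient form; it merges the deficits 1 / |C| and 1 / |D| of two
  pieces of an ultrametric space into 1 / |V|.\<close>

lemma power2_sum_divide_le:
  fixes s u p r :: real
  assumes "0 < p" "0 < r"
  shows "(s + u)\<^sup>2 / (p + r) \<le> s\<^sup>2 / p + u\<^sup>2 / r"
proof -
  have "0 \<le> (s * r - u * p)\<^sup>2" by simp
  then show ?thesis using assms
    by (simp add: field_simps power2_eq_square)
qed

text \<open>Induction on \<open>V\<close>: an open ball of maximal radius and its complement are at constant distance.\<close>

lemma ultrametric_form_le:
  fixes b :: "'e \<Rightarrow> 'e \<Rightarrow> real"
  assumes "finite V"
    and "\<And>i j. i \<in> V \<Longrightarrow> j \<in> V \<Longrightarrow> b i j = b j i"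
    and "\<And>i. i \<in> V \<Longrightarrow> b i i = 0"
    and "\<And>i j. i \<in> V \<Longrightarrow> j \<in> V \<Longrightarrow> 0 \<le> b i j"
    and "\<And>i j. i \<in> V \<Longrightarrow> j \<in> V \<Longrightarrow> b i j \<le> B" and "0 \<le> B"
    and "\<And>i j k. i \<in> V \<Longrightarrow> j \<in> V \<Longrightarrow> k \<in> V \<Longrightarrow> i \<noteq> j \<Longrightarrow> i \<noteq> k \<Longrightarrow> j \<noteq> k \<Longrightarrow>
           b i j \<le> max (b i k) (b j k)"
  shows "bform V b x x \<le> B * (1 - 1 / real (card V)) * (\<Sum>i\<in>V. x i)\<^sup>2"
  using assms
proof (induction V arbitrary: B rule: finite_psubset_induct)
  case (psubset V)
  note sym = psubset.prems(1) and diag = psubset.prems(2) and nonneg = psubset.prems(3)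
    and le_B = psubset.prems(4) and B0 = psubset.prems(5) and ultra = psubset.prems(6)
  show ?case
  proof (cases "\<exists>i\<in>V. \<exists>j\<in>V. i \<noteq> j")
    case False
    \<comment> \<open>At most one point is left. Division by 0 gives 0, so the right-hand side is
      nonnegative for empty V as well.\<close>
    then have "bform V b x x = 0"
      using diag unfolding bform_def by (intro sum.neutral ballI) (metis mult_zero_left)
    moreover have "1 / real (card V) \<le> 1"
      by (cases "card V") auto
    ultimately show ?thesis using B0 by simp
  next
    case True
    define P where "P = {p \<in> V \<times> V. fst p \<noteq> snd p}"
    have P: "finite P" "P \<noteq> {}" using psubset.hyps(1) True by (auto simp: P_def)
    define R where "R = Max ((\<lambda>p. b (fst p) (snd p)) ` P)"
    have "R \<in> (\<lambda>p. b (fst p) (snd p)) ` P"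
      unfolding R_def using P by (intro Max_in) auto
    then obtain i j where ij: "i \<in> V" "j \<in> V" "i \<noteq> j" "b i j = R" by (auto simp: P_def)
    have R0: "0 \<le> R" "R \<le> B" using ij nonneg le_B by auto
    have le_R: "b k l \<le> R" if "k \<in> V" "l \<in> V" for k l
    proof (cases "k = l")
      case True
      then show ?thesis using that diag R0 by simp
    next
      case False
      then show ?thesis unfolding R_def using that P by (intro Max_ge) (auto simp: P_def image_iff)
    qed
    \<comment> \<open>The open ball around i whose radius is the diameter R. Its centre is added by
      hand because R may be 0; j lies outside, so C and D are both proper subsets.\<close>
    define C where "C = {k \<in> V. k = i \<or> b i k < R}"
    define D where "D = V - C"
    have CD: "finite C" "finite D" "C \<inter> D = {}" "V = C \<union> D" "C \<subset> V" "D \<subset> V" "C \<noteq> {}" "D \<noteq> {}"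
      using psubset.hyps(1) ij by (auto simp: C_def D_def)
    have cross: "b k l = R" if "k \<in> C" "l \<in> D" for k l
    proof -
      have kl: "k \<in> V" "l \<in> V" "k \<noteq> l" "i \<noteq> l" "\<not> b i l < R" using that by (auto simp: C_def D_def)
      show ?thesis
      proof (cases "k = i")
        case True
        then show ?thesis using kl le_R[of k l] by simp
      next
        case False
        then have "b i k < R" using that by (simp add: C_def)
        moreover have "b i l \<le> max (b i k) (b l k)" using kl ij False by (intro ultra) auto
        ultimately show ?thesis using kl le_R[of k l] sym[of k l] by auto
      qed
    qed
    define s u where "s = (\<Sum>i\<in>C. x i)" and "u = (\<Sum>i\<in>D. x i)"
    have IH: "bform X b x x \<le> R * (1 - 1 / real (card X)) * (\<Sum>i\<in>X. x i)\<^sup>2" if X: "X \<subset> V" for X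
    proof -
      have sub: "i \<in> V" if "i \<in> X" for i using X that by blast
      show ?thesis
        by (rule psubset.IH[OF X]; (rule sym diag nonneg le_R R0 ultra)?; (erule sub)?; assumption?)
    qed
    have C: "bform C b x x \<le> R * (1 - 1 / real (card C)) * s\<^sup>2"
      and D: "bform D b x x \<le> R * (1 - 1 / real (card D)) * u\<^sup>2"
      unfolding s_def u_def using CD by (auto intro: IH)
    have card: "0 < card C" "0 < card D" "card V = card C + card D"
      using CD by (auto simp: card_gt_0_iff card_Un_disjoint)
    have "(\<Sum>i\<in>C. \<Sum>j\<in>D. b i j * x i * x j) = (\<Sum>i\<in>C. \<Sum>j\<in>D. R * x i * x j)"
      by (intro sum.cong refl) (simp add: cross)
    also have "\<dots> = R * (s * u)"
      unfolding s_def u_def sum_product by (simp add: sum_distrib_left mult.assoc)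
    finally have cross1: "(\<Sum>i\<in>C. \<Sum>j\<in>D. b i j * x i * x j) = R * (s * u)" .
    have "(\<Sum>i\<in>D. \<Sum>j\<in>C. b i j * x i * x j) = (\<Sum>i\<in>C. \<Sum>j\<in>D. b i j * x i * x j)"
      using CD by (subst sum.swap) (intro sum.cong refl, auto simp: sym)
    then have "bform V b x x = bform C b x x + bform D b x x + 2 * (R * (s * u))"
      unfolding CD(4) by (subst bform_Un) (use CD cross1 in auto)
    also have "\<dots> \<le> R * ((s + u)\<^sup>2 - (s\<^sup>2 / real (card C) + u\<^sup>2 / real (card D)))"
      using C D by (simp add: algebra_simps power2_eq_square)
    also have "\<dots> \<le> R * ((s + u)\<^sup>2 - (s + u)\<^sup>2 / real (card V))"
      using card R0(1) power2_sum_divide_le[of "real (card C)" "real (card D)" s u]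
      by (intro mult_left_mono) auto
    also have "\<dots> = R * ((1 - 1 / real (card V)) * (s + u)\<^sup>2)"
      by (simp add: algebra_simps)
    also have "\<dots> \<le> B * ((1 - 1 / real (card V)) * (s + u)\<^sup>2)"
      using R0(2) card by (intro mult_right_mono mult_nonneg_nonneg) auto
    also have "s + u = (\<Sum>i\<in>V. x i)"
      unfolding s_def u_def CD(4) using CD by (simp add: sum.union_disjoint)
    finally show ?thesis by simp
  qed
qed

lemma bform_rescale:
  assumes "\<And>i. i \<in> V \<Longrightarrow> d i \<noteq> 0"
  shows "bform V M x x = bform V (\<lambda>i j. M i j / (d i * d j)) (\<lambda>i. d i * x i) (\<lambda>i. d i * x i)"
  unfolding bform_def using assms by (intro sum.cong refl) simp

lemma bform_indicator_right:
  assumes "finite V" "a \<in> V"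
  shows "bform V M x (\<lambda>k. if k = a then 1 else 0) = (\<Sum>i\<in>V. M i a * x i)"
proof -
  have "bform V M x (\<lambda>k. if k = a then 1 else 0) = (\<Sum>i\<in>V. \<Sum>j\<in>V. if j = a then M i j * x i else 0)"
    unfolding bform_def by (intro sum.cong refl) auto
  then show ?thesis using assms by simp
qed

text \<open>Rescaling by the row of an anchor \<open>a\<close> turns the four-point condition into the ultrametric
  inequality; the rows of the elements parallel to \<open>a\<close> are proportional to that of \<open>a\<close>.\<close>

lemma lorentzian_four_point:
  fixes M :: "'e \<Rightarrow> 'e \<Rightarrow> real"
  assumes fin: "finite V"
    and sym: "\<And>i j. i \<in> V \<Longrightarrow> j \<in> V \<Longrightarrow> M i j = M j i"
    and diag: "\<And>i. i \<in> V \<Longrightarrow> M i i = 0"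
    and nonneg: "\<And>i j. i \<in> V \<Longrightarrow> j \<in> V \<Longrightarrow> 0 \<le> M i j"
    and four: "\<And>i j k l. i \<in> V \<Longrightarrow> j \<in> V \<Longrightarrow> k \<in> V \<Longrightarrow> l \<in> V \<Longrightarrow> distinct [i, j, k, l] \<Longrightarrow>
           M i j * M k l \<le> max (M i k * M j l) (M i l * M j k)"
  shows "lorentzian V M"
proof (cases "\<forall>i\<in>V. \<forall>j\<in>V. M i j = 0")
  case True
  then have "lorentzian V M \<longleftrightarrow> lorentzian V (\<lambda>i j. 0)" by (intro lorentzian_cong) auto
  then show ?thesis by (simp add: lorentzian_zero)
next
  case False
  then obtain a k where ak: "a \<in> V" "k \<in> V" "M a k \<noteq> 0" by blast
  then have pos: "0 < M a k" using nonneg[of a k] by simp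
  show ?thesis
  proof (rule lorentzianI_nonpos_on_perp[OF sym, where v = "\<lambda>k. if k = a then 1 else 0"])
    fix x assume "bform V M x (\<lambda>k. if k = a then 1 else 0) = 0"
    then have perp: "(\<Sum>i\<in>V. M a i * x i) = 0"
      using ak sym fin by (simp add: bform_indicator_right)
    define V' where "V' = {i \<in> V. 0 < M a i}"
    define U where "U = V - V'"
    have V: "finite V'" "finite U" "V' \<inter> U = {}" "V = V' \<union> U" "V' \<subseteq> V" "U \<subseteq> V"
      using fin by (auto simp: V'_def U_def)
    have U0: "M a u = 0" if "u \<in> U" for u
      using that nonneg[of a u] ak by (auto simp: U_def V'_def)
    \<comment> \<open>Two four-point inequalities on a, k, u, l, in each of which one product
      vanishes by M a u = 0, bound the two sides by each other.\<close>
    have par: "M a k * M u l = M u k * M a l" if "u \<in> U" "l \<in> V" for u l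
    proof (cases "u = a \<or> l = a \<or> l = u \<or> l = k")
      case True
      moreover have "M a u = 0" "M u a = 0" "M a a = 0" "M u u = 0"
        using U0[OF that(1)] sym[of u a] diag that(1) ak V(6) by auto
      ultimately show ?thesis by (elim disjE) simp_all
    next
      case False
      have "k \<noteq> a" "k \<noteq> u" using diag ak U0[OF that(1)] by auto
      then have d: "distinct [a, k, u, l]" "distinct [a, l, u, k]" using False by auto
      have u: "u \<in> V" using that V by auto
      have "0 \<le> M a l * M k u" "0 \<le> M a k * M l u"
        using nonneg ak that(2) u by auto
      then have "M a k * M u l \<le> M a l * M k u" "M a l * M u k \<le> M a k * M l u"
        using four[OF ak(1,2) u that(2) d(1)] four[OF ak(1) that(2) u ak(2) d(2)] U0[OF that(1)]
        by auto
      then show ?thesis using sym u that(2) ak by (auto simp: mult.commute)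
    qed
    have rowU: "(\<Sum>l\<in>V. M u l * x l) = 0" if "u \<in> U" for u
    proof -
      have "M a k * (\<Sum>l\<in>V. M u l * x l) = (\<Sum>l\<in>V. (M a k * M u l) * x l)"
        by (simp add: sum_distrib_left mult.assoc)
      also have "\<dots> = (\<Sum>l\<in>V. (M u k * M a l) * x l)"
        using par[OF that] by simp
      also have "\<dots> = M u k * (\<Sum>l\<in>V. M a l * x l)"
        by (simp add: sum_distrib_left mult.assoc)
      finally show ?thesis using perp ak by simp
    qed
    have UU: "M u i = 0" if "u \<in> U" "i \<in> U" for u i
      using par[OF that(1), of i] U0[OF that(2)] that V ak by auto
    have bU: "bform U M x x = 0"
      unfolding bform_def by (intro sum.neutral ballI) (simp add: UU)
    have "0 = (\<Sum>u\<in>U. x u * (\<Sum>l\<in>V. M u l * x l))"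
      by (simp add: rowU)
    also have "\<dots> = (\<Sum>u\<in>U. \<Sum>l\<in>V'. M u l * x u * x l) + bform U M x x"
      unfolding V(4) using V
      by (simp add: sum.union_disjoint bform_rows sum.distrib distrib_left sum_distrib_left mult_ac)
    finally have UV': "(\<Sum>u\<in>U. \<Sum>l\<in>V'. M u l * x u * x l) = 0" using bU by simp
    moreover have "(\<Sum>l\<in>V'. \<Sum>u\<in>U. M l u * x l * x u) = (\<Sum>u\<in>U. \<Sum>l\<in>V'. M u l * x u * x l)"
      using V by (subst sum.swap) (intro sum.cong refl, auto simp: sym)
    ultimately have "bform V M x x = bform V' M x x"
      unfolding V(4) by (subst bform_Un) (use V bU in auto)
    also have "\<dots> = bform V' (\<lambda>i j. M i j / (M a i * M a j)) (\<lambda>i. M a i * x i) (\<lambda>i. M a i * x i)"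
      by (rule bform_rescale) (simp add: V'_def)
    \<comment> \<open>Any upper bound on the rescaled entries serves, here their sum, because the
      squared factor is 0 by \<open>perp\<close>.\<close>
    also have "\<dots> \<le> (\<Sum>i\<in>V'. \<Sum>j\<in>V'. M i j / (M a i * M a j)) * (1 - 1 / real (card V'))
        * (\<Sum>i\<in>V'. M a i * x i)\<^sup>2"
    proof (rule ultrametric_form_le[OF V(1)])
      have nn: "0 \<le> M i j / (M a i * M a j)" if "i \<in> V'" "j \<in> V'" for i j
        using that nonneg[of i j] by (simp add: V'_def)
      then show "i \<in> V' \<Longrightarrow> j \<in> V' \<Longrightarrow> 0 \<le> M i j / (M a i * M a j)" for i j .
      show "0 \<le> (\<Sum>i\<in>V'. \<Sum>j\<in>V'. M i j / (M a i * M a j))"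
        using nn by (intro sum_nonneg) auto
      fix i j assume ij: "i \<in> V'" "j \<in> V'"
      show "M i j / (M a i * M a j) = M j i / (M a j * M a i)"
        using ij V sym by (auto simp: mult.commute)
      have "M i j / (M a i * M a j) \<le> (\<Sum>j\<in>V'. M i j / (M a i * M a j))"
        using ij nn V(1) by (intro member_le_sum) auto
      also have "\<dots> \<le> (\<Sum>i\<in>V'. \<Sum>j\<in>V'. M i j / (M a i * M a j))"
        using ij nn V(1)
        by (intro member_le_sum[where f = "\<lambda>i. \<Sum>j\<in>V'. M i j / (M a i * M a j)"]) (auto intro: sum_nonneg)
      finally show "M i j / (M a i * M a j) \<le> (\<Sum>i\<in>V'. \<Sum>j\<in>V'. M i j / (M a i * M a j))" .
    next
      fix i j k assume ijk: "i \<in> V'" "j \<in> V'" "k \<in> V'" "i \<noteq> j" "i \<noteq> k" "j \<noteq> k"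
      then have p: "0 < M a i" "0 < M a j" "0 < M a k" "i \<in> V" "j \<in> V" "k \<in> V" by (auto simp: V'_def)
      then have "a \<noteq> i" "a \<noteq> j" "a \<noteq> k" using diag by auto
      then have "M a k * M i j \<le> max (M a i * M k j) (M a j * M k i)"
        using p ak ijk by (intro four) auto
      then have "M a k * M i j \<le> M a i * M j k \<or> M a k * M i j \<le> M a j * M i k"
        using sym p by (auto simp: le_max_iff_disj)
      then show "M i j / (M a i * M a j) \<le> max (M i k / (M a i * M a k)) (M j k / (M a j * M a k))"
        using p by (auto simp: le_max_iff_disj field_simps)
    qed (use V diag in auto)
    also have "(\<Sum>i\<in>V'. M a i * x i) = (\<Sum>i\<in>V. M a i * x i)"
      unfolding V(4) using V U0 by (simp add: sum.union_disjoint)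
    finally show "bform V M x x \<le> 0" using perp by simp
  qed
qed

text \<open>The Hessian left by N - 2 derivatives in the homogenizing variable y, divided by (N -
  2)!: the terms y^N, y^(N-1) x_i and y^(N-2) x_i x_j leave the factors N (N - 1), N - 1 and
  1.\<close>

fun pointed :: "nat \<Rightarrow> real \<Rightarrow> ('e \<Rightarrow> real) \<Rightarrow> ('e \<Rightarrow> 'e \<Rightarrow> real) \<Rightarrow> 'e option \<Rightarrow> 'e option \<Rightarrow> real" where
  "pointed N a0 a1 a2 None None = real N * (real N - 1) * a0"
| "pointed N a0 a1 a2 None (Some i) = (real N - 1) * a1 i"
| "pointed N a0 a1 a2 (Some i) None = (real N - 1) * a1 i"
| "pointed N a0 a1 a2 (Some i) (Some j) = a2 i j"

lemma sum_insert_None: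
  assumes "finite E"
  shows "(\<Sum>i\<in>insert None (Some ` E). f i) = f None + (\<Sum>i\<in>E. f (Some i) :: real)"
  using assms by (subst sum.insert) (auto simp: sum.reindex)

lemma bform_pointed:
  assumes "finite E"
  shows "bform (insert None (Some ` E)) (pointed N a0 a1 a2) x x =
    real N * (real N - 1) * a0 * (x None)\<^sup>2 + 2 * (real N - 1) * x None * (\<Sum>i\<in>E. a1 i * x (Some i))
    + bform E a2 (\<lambda>i. x (Some i)) (\<lambda>i. x (Some i))"
proof -
  have "(\<Sum>i\<in>E. (real N - 1) * a1 i * x None * x (Some i))
      = (real N - 1) * x None * (\<Sum>i\<in>E. a1 i * x (Some i))"
    and "(\<Sum>i\<in>E. (real N - 1) * a1 i * x (Some i) * x None)
      = (real N - 1) * x None * (\<Sum>i\<in>E. a1 i * x (Some i))"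
    by (simp_all add: sum_distrib_left mult_ac)
  then show ?thesis
    unfolding bform_def sum_insert_None[OF assms] pointed.simps sum.distrib
    by (simp add: power2_eq_square)
qed

text \<open>The factor \<open>N (N - 1)\<close> in the entry at \<open>None\<close> is the largest that the bound \<open>1 - 1 / N\<close> of the
  ultrametric inequality allows.\<close>

lemma lorentzian_pointed:
  fixes a0 :: real and a1 :: "'e \<Rightarrow> real" and a2 :: "'e \<Rightarrow> 'e \<Rightarrow> real"
  assumes fin: "finite E" and N: "N = card E" "2 \<le> N"
    and a0: "0 \<le> a0" and a1: "\<And>i. i \<in> E \<Longrightarrow> 0 \<le> a1 i"
    and a2: "\<And>i j. i \<in> E \<Longrightarrow> j \<in> E \<Longrightarrow> 0 \<le> a2 i j"
    and sym: "\<And>i j. i \<in> E \<Longrightarrow> j \<in> E \<Longrightarrow> a2 i j = a2 j i"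
    and diag: "\<And>i. i \<in> E \<Longrightarrow> a2 i i = 0"
    and two: "\<And>i j. i \<in> E \<Longrightarrow> j \<in> E \<Longrightarrow> a0 * a2 i j \<le> a1 i * a1 j"
    and three: "\<And>i j k. i \<in> E \<Longrightarrow> j \<in> E \<Longrightarrow> k \<in> E \<Longrightarrow> distinct [i, j, k] \<Longrightarrow>
           a1 k * a2 i j \<le> max (a1 i * a2 j k) (a1 j * a2 i k)"
    and four: "\<And>i j k l. i \<in> E \<Longrightarrow> j \<in> E \<Longrightarrow> k \<in> E \<Longrightarrow> l \<in> E \<Longrightarrow> distinct [i, j, k, l] \<Longrightarrow>
           a2 i j * a2 k l \<le> max (a2 i k * a2 j l) (a2 i l * a2 j k)"
  shows "lorentzian (insert None (Some ` E)) (pointed N a0 a1 a2)"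
\<comment> \<open>For a0 = 0 the diagonal vanishes and None is one more point of a four-point
  matrix, \<open>three\<close> covering the quadruples through it. For a0 > 0 orthogonality to None
  determines x None, and \<open>two\<close> bounds the rescaled distances on E by 1 / a0.\<close>
proof (cases "a0 = 0")
  case True
  let ?M = "pointed N a0 a1 a2"
  have three': "(real N - 1) * a1 k * a2 i j
      \<le> max ((real N - 1) * a1 i * a2 j k) ((real N - 1) * a1 j * a2 i k)"
    if "i \<in> E" "j \<in> E" "k \<in> E" "distinct [i, j, k]" for i j k
    using mult_left_mono[OF three[OF that], of "real N - 1"] N(2)
    by (auto simp: max_mult_distrib_left mult.assoc)
  have M_sym: "?M i j = ?M j i" if "i \<in> insert None (Some ` E)" "j \<in> insert None (Some ` E)" for i j
    using that sym by auto
  show ?thesis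
  proof (rule lorentzian_four_point)
    fix i j k l :: "'e option"
    assume V: "i \<in> insert None (Some ` E)" "j \<in> insert None (Some ` E)"
      "k \<in> insert None (Some ` E)" "l \<in> insert None (Some ` E)" and d: "distinct [i, j, k, l]"
    have at_None: "?M None q * ?M r s \<le> max (?M None r * ?M q s) (?M None s * ?M q r)"
      if qrs: "q \<in> insert None (Some ` E)" "r \<in> insert None (Some ` E)" "s \<in> insert None (Some ` E)"
        "distinct [None, q, r, s]" for q r s
    proof -
      obtain q' r' s' where o: "q = Some q'" "r = Some r'" "s = Some s'" "q' \<in> E" "r' \<in> E" "s' \<in> E"
        using qrs by auto
      then show ?thesis
        using three'[of r' s' q'] qrs(4) sym[of s' q'] sym[of r' q'] by auto
    qed
    consider "i = None" | "j = None" | "k = None" | "l = None"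
      | "i \<noteq> None" "j \<noteq> None" "k \<noteq> None" "l \<noteq> None" by blast
    then show "?M i j * ?M k l \<le> max (?M i k * ?M j l) (?M i l * ?M j k)"
    proof cases
      case 1
      then show ?thesis using d V by (auto intro!: at_None simp del: pointed.simps)
    next
      case 2
      then show ?thesis
        using at_None[of i k l] M_sym[of i j] V d
        by (auto simp: le_max_iff_disj mult.commute simp del: pointed.simps)
    next
      case 3
      then show ?thesis
        using at_None[of l i j] M_sym[of i k] M_sym[of j k] M_sym[of j l] M_sym[of i l] V d
        by (auto simp: le_max_iff_disj mult.commute simp del: pointed.simps)
    next
      case 4
      then show ?thesis
        using at_None[of k i j] M_sym[of k l] M_sym[of j l] M_sym[of i l] M_sym[of j k] M_sym[of i k] V d
        by (auto simp: le_max_iff_disj mult.commute simp del: pointed.simps)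
    next
      case 5
      then obtain i' j' k' l' where "i = Some i'" "j = Some j'" "k = Some k'" "l = Some l'"
        "i' \<in> E" "j' \<in> E" "k' \<in> E" "l' \<in> E" using V by auto
      then show ?thesis using d four[of i' j' k' l'] by auto
    qed
  qed (use fin True a1 a2 diag sym N in auto)
next
  case False
  then have a0: "0 < a0" using a0 by simp
  let ?V = "insert None (Some ` E)" and ?M = "pointed N a0 a1 a2"
  show ?thesis
  proof (rule lorentzianI_nonpos_on_perp[where v = "\<lambda>k. if k = None then 1 else 0"])
    fix x assume v: "bform ?V ?M x (\<lambda>k. if k = None then 1 else 0) = 0"
    have "bform ?V ?M x (\<lambda>k. if k = None then 1 else 0) = (\<Sum>i\<in>?V. ?M i None * x i)"
      using fin by (intro bform_indicator_right) auto
    with v have perp: "real N * (real N - 1) * a0 * x None + (real N - 1) * (\<Sum>i\<in>E. a1 i * x (Some i)) = 0"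
      unfolding sum_insert_None[OF fin] by (simp add: sum_distrib_left mult.assoc)
    define s where "s = (\<Sum>i\<in>E. a1 i * x (Some i))"
    define y where "y = (\<lambda>i. x (Some i))"
    have "(real N - 1) * (real N * a0 * x None + s) = 0"
      using perp by (simp add: s_def algebra_simps)
    moreover have "real N - 1 \<noteq> 0" using N(2) by auto
    ultimately have "real N * a0 * x None + s = 0" by (simp only: mult_eq_0_iff) blast
    then have x0: "x None = - s / (real N * a0)"
      using N(2) a0 by (simp add: field_simps)
    define V' where "V' = {i \<in> E. 0 < a1 i}"
    have V': "V' \<subseteq> E" "finite V'" using fin by (auto simp: V'_def)
    have z1: "a1 i = 0" if "i \<in> E" "i \<notin> V'" for i
      using that a1[of i] by (auto simp: V'_def)
    \<comment> \<open>Because a0 > 0, \<open>two\<close> makes the row of a2 vanish wherever a1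
      does, so restricting to V' and dividing by a1 loses nothing.\<close>
    have z2: "a2 i j = 0" if "i \<in> E" "j \<in> E" "i \<notin> V' \<or> j \<notin> V'" for i j
    proof -
      have "a0 * a2 i j \<le> 0" using two[OF that(1,2)] z1 that by auto
      then show ?thesis using a0 a2[OF that(1,2)] by (simp add: mult_le_0_iff)
    qed
    have "bform E a2 y y = bform V' a2 y y"
      using fin V' z2 by (intro bform_superset) auto
    also have "\<dots> = bform V' (\<lambda>i j. a2 i j / (a1 i * a1 j)) (\<lambda>i. a1 i * y i) (\<lambda>i. a1 i * y i)"
      by (rule bform_rescale) (simp add: V'_def)
    also have "\<dots> \<le> 1 / a0 * (1 - 1 / real (card V')) * (\<Sum>i\<in>V'. a1 i * y i)\<^sup>2"
    proof (rule ultrametric_form_le[OF V'(2)])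
      fix i j assume ij: "i \<in> V'" "j \<in> V'"
      then have E: "i \<in> E" "j \<in> E" "0 < a1 i" "0 < a1 j" by (auto simp: V'_def)
      show "a2 i j / (a1 i * a1 j) = a2 j i / (a1 j * a1 i)"
        using E sym by (simp add: mult.commute)
      show "0 \<le> a2 i j / (a1 i * a1 j)" using E a2 by simp
      show "a2 i j / (a1 i * a1 j) \<le> 1 / a0" using E two[OF E(1,2)] a0 by (simp add: field_simps)
    next
      fix i j k assume ijk: "i \<in> V'" "j \<in> V'" "k \<in> V'" "i \<noteq> j" "i \<noteq> k" "j \<noteq> k"
      then have p: "0 < a1 i" "0 < a1 j" "0 < a1 k" "i \<in> E" "j \<in> E" "k \<in> E" by (auto simp: V'_def)
      then have "a1 k * a2 i j \<le> a1 i * a2 j k \<or> a1 k * a2 i j \<le> a1 j * a2 i k"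
        using three[of i j k] ijk by (auto simp: le_max_iff_disj)
      then show "a2 i j / (a1 i * a1 j) \<le> max (a2 i k / (a1 i * a1 k)) (a2 j k / (a1 j * a1 k))"
        using p by (auto simp: le_max_iff_disj field_simps)
    qed (use V' diag a0 in auto)
    also have "(\<Sum>i\<in>V'. a1 i * y i) = s"
      unfolding s_def y_def using V' fin z1 by (intro sum.mono_neutral_left) auto
    finally have "bform E a2 y y \<le> 1 / a0 * (1 - 1 / real (card V')) * s\<^sup>2" .
    also have "\<dots> \<le> 1 / a0 * (1 - 1 / real N) * s\<^sup>2"
    proof (cases "V' = {}")
      case True
      then have "s = 0" unfolding s_def using z1 by (intro sum.neutral) auto
      then show ?thesis by simp
    next
      case False
      then have "0 < card V'" "card V' \<le> N"
        using V' fin N by (auto simp: card_mono card_gt_0_iff)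
      then have "1 / real N \<le> 1 / real (card V')" by (intro frac_le) auto
      then show ?thesis using a0 by (intro mult_right_mono mult_left_mono) auto
    qed
    finally have "bform ?V ?M x x \<le> real N * (real N - 1) * a0 * (x None)\<^sup>2
        + 2 * (real N - 1) * x None * s + 1 / a0 * (1 - 1 / real N) * s\<^sup>2"
      unfolding bform_pointed[OF fin] s_def y_def by simp
    \<comment> \<open>With the value of x None the first two terms sum to - (1 - 1 / N) * s^2 / a0:
      the cancellation is exact.\<close>
    also have "\<dots> = 0"
      unfolding x0 using a0 N(2) by (simp add: field_simps power2_eq_square)
    finally show "bform ?V ?M x x \<le> 0" .
  next
    show "?M i j = ?M j i" if "i \<in> ?V" "j \<in> ?V" for i j
      using that sym by auto
  qed
qed

subsection \<open>Generating polynomials of M-natural-concave weights\<close>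

text \<open>M-natural-concavity in multiplicative form; the value -\<infinity> becomes the weight 0,
  so only real numbers occur.\<close>

definition exchange :: "'e set \<Rightarrow> ('e set \<Rightarrow> real) \<Rightarrow> bool" where
  "exchange E w \<longleftrightarrow> (\<forall>A B i. A \<subseteq> E \<longrightarrow> B \<subseteq> E \<longrightarrow> i \<in> A - B \<longrightarrow>
     w A * w B \<le> w (A - {i}) * w (insert i B) \<or>
     (\<exists>j\<in>B - A. w A * w B \<le> w (insert j (A - {i})) * w (insert i (B - {j}))))"

lemma exchangeD:
  assumes "exchange E w" "A \<subseteq> E" "B \<subseteq> E" "i \<in> A" "i \<notin> B"
  shows "w A * w B \<le> w (A - {i}) * w (insert i B) \<or>
     (\<exists>j\<in>B - A. w A * w B \<le> w (insert j (A - {i})) * w (insert i (B - {j})))"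
  using assms unfolding exchange_def by blast

text \<open>Removing i from A adds i to E - A, so the exchange for E - B and E - A is the one for A
  and B with the two factors swapped. The second generating polynomial is indexed by
  complements.\<close>

lemma exchange_complement:
  assumes "exchange E w"
  shows "exchange E (\<lambda>I. w (E - I))"
  unfolding exchange_def
proof (intro allI impI)
  fix A B i assume AB: "A \<subseteq> E" "B \<subseteq> E" "i \<in> A - B"
  have "w (E - B) * w (E - A) \<le> w (E - B - {i}) * w (insert i (E - A)) \<or>
     (\<exists>j\<in>(E - A) - (E - B). w (E - B) * w (E - A) \<le>
        w (insert j (E - B - {i})) * w (insert i (E - A - {j})))"
    using AB by (intro exchangeD[OF assms]) auto
  moreover have "E - B - {i} = E - insert i B" "insert i (E - A) = E - (A - {i})"
    using AB by auto
  moreover have "insert j (E - B - {i}) = E - insert i (B - {j})"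
    "insert i (E - A - {j}) = E - insert j (A - {i})" if "j \<in> B - A" for j
    using AB that by auto
  moreover have "(E - A) - (E - B) = B - A" using AB by auto
  ultimately show "w (E - A) * w (E - B) \<le> w (E - (A - {i})) * w (E - insert i B) \<or>
      (\<exists>j\<in>B - A. w (E - A) * w (E - B) \<le> w (E - insert j (A - {i})) * w (E - insert i (B - {j})))"
    by (auto simp: mult.commute)
qed

text \<open>The smaller set lies inside the larger one and has nothing to give back, so only the
  first alternative of the exchange remains.\<close>

lemma exchange_two:
  assumes "exchange E w" "C \<subseteq> E" "i \<in> E - C" "j \<in> E - C" "i \<noteq> j"
  shows "w C * w (insert i (insert j C)) \<le> w (insert i C) * w (insert j C)"
proof -
  have "insert i (insert j C) - {i} = insert j C" "C - insert i (insert j C) = {}"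
    using assms by auto
  then show ?thesis
    using exchangeD[OF assms(1), of "insert i (insert j C)" C i] assms by (auto simp: mult.commute)
qed

text \<open>Only k can be given back for i; moving i alone and swapping i with k produce the two
  products.\<close>

lemma exchange_three:
  assumes "exchange E w" "C \<subseteq> E" "i \<in> E - C" "j \<in> E - C" "k \<in> E - C" "distinct [i, j, k]"
  shows "w (insert k C) * w (insert i (insert j C))
    \<le> max (w (insert i C) * w (insert j (insert k C))) (w (insert j C) * w (insert i (insert k C)))"
proof -
  have "insert i (insert j C) - {i} = insert j C" "insert k C - insert i (insert j C) = {k}"
    "insert k C - {k} = C" "insert k (insert j C) = insert j (insert k C)"
    using assms by auto
  then show ?thesis
    using exchangeD[OF assms(1), of "insert i (insert j C)" "insert k C" i] assms
    by (auto simp: mult.commute le_max_iff_disj)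
qed

text \<open>Exchanging between two-element and two-element extensions of \<open>C\<close> may pass through a
  one-element and a three-element extension. If all four such products dominate, then
  \<open>exchange_two\<close>, applied once to each triple, bounds the product of the four.\<close>

lemma exchange_four:
  assumes ex: "exchange E w" and w: "\<And>I. 0 \<le> w I" and C: "C \<subseteq> E"
    and el: "i \<in> E - C" "j \<in> E - C" "k \<in> E - C" "l \<in> E - C" "distinct [i, j, k, l]"
  shows "w (insert i (insert j C)) * w (insert k (insert l C))
    \<le> max (w (insert i (insert k C)) * w (insert j (insert l C)))
          (w (insert i (insert l C)) * w (insert j (insert k C)))"
proof (rule ccontr)
  define W2 where "W2 = (\<lambda>a b. w (insert a (insert b C)))"
  define W1 where "W1 = (\<lambda>a. w (insert a C))"
  define W3 where "W3 = (\<lambda>a b c. w (insert a (insert b (insert c C))))"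
  have W2c: "W2 a b = W2 b a" for a b by (simp add: W2_def insert_commute)
  assume "\<not> ?thesis"
  then have m: "W2 i k * W2 j l < W2 i j * W2 k l" "W2 i l * W2 j k < W2 i j * W2 k l"
    by (auto simp: W2_def)
  have T: "W2 a b * W2 c d \<le> W1 b * W3 a c d \<or> W2 a b * W2 c d \<le> W2 a c * W2 b d
      \<or> W2 a b * W2 c d \<le> W2 a d * W2 b c"
    if "a \<in> E - C" "b \<in> E - C" "c \<in> E - C" "d \<in> E - C" "distinct [a, b, c, d]" for a b c d
  proof -
    have "insert a (insert b C) - {a} = insert b C" "insert c (insert d C) - insert a (insert b C) = {c, d}"
      "insert c (insert d C) - {c} = insert d C" "insert c (insert d C) - {d} = insert c C"
      using that by auto
    then show ?thesis
      using exchangeD[OF ex, of "insert a (insert b C)" "insert c (insert d C)" a] that C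
      by (auto simp: W1_def W2_def W3_def insert_commute mult.commute)
  qed
  \<comment> \<open>By \<open>m\<close> no swap alternative can hold, so the exchange at each of the
    four elements must move that element alone to the other set.\<close>
  have P: "W2 i j * W2 k l \<le> W1 j * W3 i k l" "W2 i j * W2 k l \<le> W1 i * W3 j k l"
    "W2 i j * W2 k l \<le> W1 l * W3 k i j" "W2 i j * W2 k l \<le> W1 k * W3 l i j"
    using T[of i j k l] T[of j i k l] T[of k l i j] T[of l k i j] el m W2c
    by (auto simp: mult.commute)
  have U: "W1 a * W3 a b c \<le> W2 a b * W2 a c"
    if "a \<in> E - C" "b \<in> E - C" "c \<in> E - C" "distinct [a, b, c]" for a b c
    using exchange_two[OF ex, of "insert a C" b c] that C
    by (auto simp: W1_def W2_def W3_def insert_commute)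
  let ?P = "W2 i j * W2 k l" and ?m = "W2 i k * W2 j l" and ?n = "W2 i l * W2 j k"
  have nn: "0 \<le> W1 a" "0 \<le> W2 a b" "0 \<le> W3 a b c" for a b c
    using w by (simp_all add: W1_def W2_def W3_def)
  have P0: "0 \<le> ?P" using nn by simp
  have "(?P * ?P) * (?P * ?P) \<le> ((W1 i * W3 j k l) * (W1 j * W3 i k l)) * ((W1 k * W3 l i j) * (W1 l * W3 k i j))"
    using nn by (intro mult_mono[OF mult_mono[OF P(2) P(1)] mult_mono[OF P(4) P(3)]] mult_nonneg_nonneg)
  \<comment> \<open>Each W1 is regrouped with a W3 containing its element, and so that after
    \<open>U\<close> neither W2 i j nor W2 k l occurs: the four remaining pairs appear twice
    each.\<close>
  also have "\<dots> = ((W1 i * W3 i k l) * (W1 j * W3 j k l)) * ((W1 l * W3 l i j) * (W1 k * W3 k i j))"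
    by (simp add: mult_ac)
  also have "\<dots> \<le> ((W2 i k * W2 i l) * (W2 j k * W2 j l)) * ((W2 l i * W2 l j) * (W2 k i * W2 k j))"
    using el nn by (intro mult_mono[OF mult_mono[OF U U] mult_mono[OF U U]] mult_nonneg_nonneg) auto
  also have "\<dots> = (?m * ?n) * (?m * ?n)"
    unfolding W2c[of l i] W2c[of l j] W2c[of k i] W2c[of k j] by (simp add: mult_ac)
  also have "\<dots> < (?P * ?P) * (?P * ?P)"
  proof -
    have mn: "0 \<le> ?m" "0 \<le> ?n" "0 \<le> ?m * ?n" using nn by simp_all
    have lt: "?m * ?n < ?P * ?P" by (rule mult_strict_mono'[OF m mn(1,2)])
    show ?thesis by (rule mult_strict_mono'[OF lt lt mn(3,3)])
  qed
  finally show False by simp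
qed

text \<open>The derivatives of order \<open>n = |E|\<close> of \<open>\<Sum>I. w I x\<^sup>I y^(n - |I|)\<close>, where \<open>Some a\<close> stands for \<open>x\<^sub>a\<close> and
  \<open>None\<close> for the homogenizing variable \<open>y\<close>.\<close>

definition coeff :: "'e set \<Rightarrow> ('e set \<Rightarrow> real) \<Rightarrow> 'e option multiset \<Rightarrow> real" where
  "coeff E w \<beta> = (if size \<beta> = card E \<and> (\<forall>a. count \<beta> (Some a) \<le> 1)
     then w {a. Some a \<in># \<beta>} * fact (count \<beta> None) else 0)"

lemma coeff_nonneg: "(\<And>I. 0 \<le> w I) \<Longrightarrow> 0 \<le> coeff E w \<beta>"
  by (simp add: coeff_def)

lemma size_option_mset:
  assumes "finite E" "set_mset \<beta> \<subseteq> insert None (Some ` E)" "\<And>a. count \<beta> (Some a) \<le> 1"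
  shows "size \<beta> = count \<beta> None + card {a. Some a \<in># \<beta>}"
proof -
  let ?C = "{a. Some a \<in># \<beta>}"
  have fin: "finite ?C" using assms(1,2) by (auto intro: finite_subset[of _ E])
  have "size \<beta> = sum (count \<beta>) (set_mset \<beta>)" by (rule size_multiset_overloaded_eq)
  also have "\<dots> = sum (count \<beta>) (insert None (Some ` ?C))"
    using fin assms(2) by (intro sum.mono_neutral_left) (auto simp: not_in_iff)
  also have "\<dots> = count \<beta> None + (\<Sum>a\<in>?C. count \<beta> (Some a))"
    using fin by (subst sum.insert) (auto simp: sum.reindex)
  also have "(\<Sum>a\<in>?C. count \<beta> (Some a)) = (\<Sum>a\<in>?C. 1)"
  proof (intro sum.cong refl)
    fix a assume "a \<in> ?C"
    then have "0 < count \<beta> (Some a)" by (simp add: count_greater_zero_iff)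
    then show "count \<beta> (Some a) = 1" using assms(3)[of a] by linarith
  qed
  finally show ?thesis by simp
qed

text \<open>Differentiating twice by the same x_a gives 0. Otherwise the elements in \<beta> form a
  set C, only extensions of C by at most two elements matter, and the matrix is (N - 2)! times a
  \<open>pointed\<close> one with N = |E - C|.\<close>

lemma lorentzian_coeff:
  assumes fin: "finite E" and ex: "exchange E w" and w: "\<And>I. 0 \<le> w I"
    and \<beta>: "size \<beta> + 2 = card E" "set_mset \<beta> \<subseteq> insert None (Some ` E)"
  shows "lorentzian (insert None (Some ` E)) (\<lambda>x y. coeff E w (\<beta> + {#x, y#}))"
proof (cases "\<forall>a. count \<beta> (Some a) \<le> 1")
  case False
  then obtain a where "\<not> count \<beta> (Some a) \<le> 1" by blast
  then have "\<not> (\<forall>b. count (\<beta> + {#x, y#}) (Some b) \<le> 1)" for x y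
    by (intro notI) (drule spec[of _ a], simp split: if_splits)
  then have "(\<lambda>x y. coeff E w (\<beta> + {#x, y#})) = (\<lambda>x y. 0)"
    unfolding coeff_def by (intro ext) (simp only: simp_thms if_False)
  then show ?thesis by (simp add: lorentzian_zero)
next
  case True
  define C where "C = {a. Some a \<in># \<beta>}"
  define N where "N = card (E - C)"
  have C: "C \<subseteq> E" using \<beta>(2) by (auto simp: C_def)
  have cardE: "card E = N + card C"
    using C fin by (simp add: N_def card_Diff_subset finite_subset card_mono)
  have N: "2 \<le> N" "count \<beta> None = N - 2"
    using size_option_mset[OF fin \<beta>(2)] True \<beta>(1) cardE by (auto simp: C_def)
  obtain m where m: "N = Suc (Suc m)" using N(1) by (metis add_2_eq_Suc le_Suc_ex)
  have cnt: "count \<beta> (Some a) = (if a \<in> C then 1 else 0)" for a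
    using True[rule_format, of a] count_greater_zero_iff[of \<beta> "Some a"]
    by (cases "count \<beta> (Some a)") (auto simp: C_def)
  \<comment> \<open>The polynomial is affine in each x_a, so the diagonal is 0;
    \<open>insert i (insert i C)\<close> would collapse to a one-element extension.\<close>
  define a2 where "a2 = (\<lambda>i j. if i = j then 0 else w (insert i (insert j C)))"
  have L: "lorentzian (insert None (Some ` (E - C))) (pointed N (w C) (\<lambda>i. w (insert i C)) a2)"
  proof (rule lorentzian_pointed[OF _ N_def N(1)])
    show "a2 i j * a2 k l \<le> max (a2 i k * a2 j l) (a2 i l * a2 j k)"
      if "i \<in> E - C" "j \<in> E - C" "k \<in> E - C" "l \<in> E - C" "distinct [i, j, k, l]" for i j k l
      using exchange_four[OF ex w C that] that(5) by (simp add: a2_def)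
    show "w (insert k C) * a2 i j \<le> max (w (insert i C) * a2 j k) (w (insert j C) * a2 i k)"
      if "i \<in> E - C" "j \<in> E - C" "k \<in> E - C" "distinct [i, j, k]" for i j k
      using exchange_three[OF ex C that] that(4) by (simp add: a2_def)
    show "w C * a2 i j \<le> w (insert i C) * w (insert j C)" if "i \<in> E - C" "j \<in> E - C" for i j
      using exchange_two[OF ex C that] w by (auto simp: a2_def)
  qed (use fin w in \<open>auto simp: a2_def insert_commute\<close>)
  have eq: "coeff E w (\<beta> + {#x, y#}) = fact m * pointed N (w C) (\<lambda>i. w (insert i C)) a2 x y"
    if xy: "x \<in> insert None (Some ` (E - C))" "y \<in> insert None (Some ` (E - C))" for x y
  proof -
    have sz: "size (\<beta> + {#x, y#}) = card E" using \<beta>(1) by simp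
    consider "x = None" "y = None" | i where "x = None" "y = Some i" "i \<in> E - C"
      | i where "x = Some i" "y = None" "i \<in> E - C"
      | i where "x = Some i" "y = Some i" "i \<in> E - C"
      | i j where "x = Some i" "y = Some j" "i \<in> E - C" "j \<in> E - C" "i \<noteq> j"
      using xy by blast
    then show ?thesis
    proof cases
      case 1
      have "{a. Some a \<in># \<beta> + {#x, y#}} = C" using 1 by (auto simp: C_def)
      moreover have "\<forall>a. count (\<beta> + {#x, y#}) (Some a) \<le> 1" using 1 by (auto simp: cnt)
      moreover have "count (\<beta> + {#x, y#}) None = Suc (Suc m)" using 1 N m by simp
      ultimately show ?thesis unfolding coeff_def sz using 1 by (simp add: m algebra_simps)
    next
      case (2 i)
      have "{a. Some a \<in># \<beta> + {#x, y#}} = insert i C" using 2 by (auto simp: C_def)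
      moreover have "\<forall>a. count (\<beta> + {#x, y#}) (Some a) \<le> 1" using 2 by (auto simp: cnt)
      moreover have "count (\<beta> + {#x, y#}) None = Suc m" using 2 N m by simp
      ultimately show ?thesis unfolding coeff_def sz using 2 by (simp add: m algebra_simps)
    next
      case (3 i)
      have "{a. Some a \<in># \<beta> + {#x, y#}} = insert i C" using 3 by (auto simp: C_def)
      moreover have "\<forall>a. count (\<beta> + {#x, y#}) (Some a) \<le> 1" using 3 by (auto simp: cnt)
      moreover have "count (\<beta> + {#x, y#}) None = Suc m" using 3 N m by simp
      ultimately show ?thesis unfolding coeff_def sz using 3 by (simp add: m algebra_simps)
    next
      case (4 i)
      have "\<not> count (\<beta> + {#x, y#}) (Some i) \<le> 1" using 4 by simp
      then have "coeff E w (\<beta> + {#x, y#}) = 0" unfolding coeff_def by (metis (no_types))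
      then show ?thesis using 4 by (simp add: a2_def)
    next
      case (5 i j)
      have "{a. Some a \<in># \<beta> + {#x, y#}} = insert i (insert j C)" using 5 by (auto simp: C_def)
      moreover have "\<forall>a. count (\<beta> + {#x, y#}) (Some a) \<le> 1" using 5 by (auto simp: cnt)
      moreover have "count (\<beta> + {#x, y#}) None = m" using 5 N m by simp
      ultimately show ?thesis unfolding coeff_def sz using 5 by (simp add: a2_def)
    qed
  qed
  show ?thesis
  proof (rule lorentzian_superset[where V = "insert None (Some ` (E - C))"])
    show "lorentzian (insert None (Some ` (E - C))) (\<lambda>x y. coeff E w (\<beta> + {#x, y#}))"
      using lorentzian_scale[OF _ L, of "fact m"] by (subst lorentzian_cong[OF eq]) auto
    fix x y :: "'a option"
    assume "x \<in> insert None (Some ` E)" "y \<in> insert None (Some ` E)"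
      "x \<notin> insert None (Some ` (E - C)) \<or> y \<notin> insert None (Some ` (E - C))"
    then obtain a where a: "a \<in> C" "x = Some a \<or> y = Some a" by auto
    then have "\<not> count (\<beta> + {#x, y#}) (Some a) \<le> 1" using cnt[of a] by auto
    then show "coeff E w (\<beta> + {#x, y#}) = 0" unfolding coeff_def by (metis (no_types))
  qed (use fin in auto)
qed

section \<open>Connectedness of the support graph of one polynomial\<close>

lemma linked_iff:
  assumes "\<And>\<gamma>. c \<gamma> \<noteq> 0 \<Longrightarrow> size \<gamma> = m + 2" "set_mset \<alpha> \<subseteq> V"
  shows "(x, y) \<in> linked V m c \<alpha> \<longleftrightarrow>
    x \<in> V \<and> y \<in> V \<and> (\<exists>\<gamma>. 0 < c \<gamma> \<and> set_mset \<gamma> \<subseteq> V \<and> \<alpha> + {#x, y#} \<subseteq># \<gamma>)"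
proof
  assume "(x, y) \<in> linked V m c \<alpha>"
  then obtain \<beta> where "x \<in> V" "y \<in> V" "set_mset \<beta> \<subseteq> V" "0 < c (\<beta> + \<alpha> + {#x, y#})"
    by (auto simp: linked_def)
  then show "x \<in> V \<and> y \<in> V \<and> (\<exists>\<gamma>. 0 < c \<gamma> \<and> set_mset \<gamma> \<subseteq> V \<and> \<alpha> + {#x, y#} \<subseteq># \<gamma>)"
    using assms(2) by (intro conjI exI[of _ "\<beta> + \<alpha> + {#x, y#}"]) (simp_all add: add.assoc)
next
  assume "x \<in> V \<and> y \<in> V \<and> (\<exists>\<gamma>. 0 < c \<gamma> \<and> set_mset \<gamma> \<subseteq> V \<and> \<alpha> + {#x, y#} \<subseteq># \<gamma>)"
  then obtain \<gamma> where \<gamma>: "x \<in> V" "y \<in> V" "0 < c \<gamma>" "set_mset \<gamma> \<subseteq> V" "\<alpha> + {#x, y#} \<subseteq># \<gamma>"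
    by blast
  define \<beta> where "\<beta> = \<gamma> - (\<alpha> + {#x, y#})"
  have eq: "\<gamma> = \<beta> + (\<alpha> + {#x, y#})"
    using \<gamma>(5) unfolding \<beta>_def by (rule subset_mset.diff_add[symmetric])
  \<comment> \<open>Homogeneity of degree m + 2 makes the size condition in \<open>linked\<close>
    automatic; an edge is just a support multiset containing \<alpha> and both endpoints.\<close>
  have "size \<gamma> = m + 2" using assms(1)[of \<gamma>] \<gamma>(3) by simp
  then have "size \<beta> + size \<alpha> = m" using eq by simp
  moreover have "set_mset \<beta> \<subseteq> V" using \<gamma>(4) unfolding eq by simp
  moreover have "0 < c (\<beta> + \<alpha> + {#x, y#})" using \<gamma>(3) unfolding add.assoc eq[symmetric] .
  ultimately show "(x, y) \<in> linked V m c \<alpha>"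
    using \<gamma>(1,2) unfolding linked_def by blast
qed

lemma linked_sym: "(x, y) \<in> linked V m c \<alpha> \<Longrightarrow> (y, x) \<in> linked V m c \<alpha>"
  unfolding linked_def by (auto simp: add_mset_commute)

lemma linked_rtrancl_sym: "(x, y) \<in> (linked V m c \<alpha>)\<^sup>* \<Longrightarrow> (y, x) \<in> (linked V m c \<alpha>)\<^sup>*"
  by (meson linked_sym symD symI sym_rtrancl)

text \<open>The exponent of x^I y^(n - |I|). Among multisets over the variables these are the only
  ones at which \<open>coeff\<close> can be positive.\<close>

definition completion :: "'e set \<Rightarrow> 'e set \<Rightarrow> 'e option multiset" where
  "completion E I = mset_set (Some ` I) + replicate_mset (card E - card I) None"

lemma count_completion:
  assumes "finite I"
  shows "count (completion E I) (Some a) = (if a \<in> I then 1 else 0)"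
    and "count (completion E I) None = card E - card I"
  using assms by (auto simp: completion_def count_mset_set')

lemma completion_props:
  assumes "finite E" "I \<subseteq> E"
  shows "size (completion E I) = card E" "set_mset (completion E I) \<subseteq> insert None (Some ` E)"
    "coeff E w (completion E I) = w I * fact (card E - card I)"
proof -
  have fin: "finite I" using assms finite_subset by blast
  show sz: "size (completion E I) = card E"
    using assms by (simp add: completion_def card_mono card_image)
  show "set_mset (completion E I) \<subseteq> insert None (Some ` E)"
    using assms fin by (auto simp: completion_def split: if_splits)
  have "{a. Some a \<in># completion E I} = I"
    using count_completion(1)[OF fin, of E] by (auto simp flip: count_greater_zero_iff split: if_splits)
  then show "coeff E w (completion E I) = w I * fact (card E - card I)"
    by (simp add: coeff_def sz count_completion[OF fin])
qed

lemma coeff_pos_imp_completion: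
  assumes "finite E" "set_mset \<gamma> \<subseteq> insert None (Some ` E)" "0 < coeff E w \<gamma>"
  obtains I where "I \<subseteq> E" "0 < w I" "\<gamma> = completion E I"
proof -
  define I where "I = {a. Some a \<in># \<gamma>}"
  have \<gamma>: "size \<gamma> = card E" "\<And>a. count \<gamma> (Some a) \<le> 1" "0 < w I"
    using assms(3) by (auto simp: coeff_def I_def zero_less_mult_iff split: if_splits)
  have I: "I \<subseteq> E" "finite I" using assms(1,2) by (auto simp: I_def intro: finite_subset[of _ E])
  have "count \<gamma> None = card E - card I"
    using size_option_mset[OF assms(1,2) \<gamma>(2)] \<gamma>(1) by (simp add: I_def)
  moreover have "count \<gamma> (Some a) = (if a \<in> I then 1 else 0)" for a
    using \<gamma>(2)[of a] count_greater_zero_iff[of \<gamma> "Some a"]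
    by (cases "count \<gamma> (Some a)") (auto simp: I_def)
  ultimately have "\<gamma> = completion E I"
    by (intro multiset_eqI) (case_tac x, simp_all add: count_completion[OF I(2)])
  then show thesis using that I \<gamma> by blast
qed

text \<open>For each support set I compatible with \<alpha>, the distinct variables of the residue
  \<open>R I\<close> form a clique, and at least three variables, counted with multiplicity, remain.
  Exchange at i between compatible I and J yields a compatible set that contains i and whose residue
  shares another variable with that of J, which joins the cliques. If some residue contains None, it
  serves as a hub; otherwise all compatible sets have size n' and only swaps occur.\<close>

lemma linked_coeff_connected:
  fixes w :: "'e set \<Rightarrow> real"
  assumes fin: "finite E" and ex: "exchange E w" and w: "\<And>I. 0 \<le> w I"
    and \<alpha>: "set_mset \<alpha> \<subseteq> insert None (Some ` E)" "size \<alpha> + 3 \<le> card E"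
    and dom: "x \<in> Domain (linked (insert None (Some ` E)) (card E - 2) (coeff E w) \<alpha>)"
      "y \<in> Domain (linked (insert None (Some ` E)) (card E - 2) (coeff E w) \<alpha>)"
  shows "(x, y) \<in> (linked (insert None (Some ` E)) (card E - 2) (coeff E w) \<alpha>)\<^sup>*"
proof -
  let ?V = "insert None (Some ` E)"
  define L where "L = linked ?V (card E - 2) (coeff E w) \<alpha>"
  define good where "good = (\<lambda>I. I \<subseteq> E \<and> 0 < w I \<and> \<alpha> \<subseteq># completion E I)"
  define R where "R = (\<lambda>I. completion E I - \<alpha>)"
  have sizes: "coeff E w \<gamma> \<noteq> 0 \<Longrightarrow> size \<gamma> = card E - 2 + 2" for \<gamma>
    using \<alpha>(2) by (auto simp: coeff_def split: if_splits)
  have L_intro: "(p, q) \<in> L" if "good I" "{#p, q#} \<subseteq># R I" for p q I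
  proof -
    have I: "I \<subseteq> E" "0 < w I" "\<alpha> \<subseteq># completion E I" using that by (auto simp: good_def)
    have sub: "\<alpha> + {#p, q#} \<subseteq># completion E I"
      using that(2) I(3) unfolding R_def
      by (metis add.commute subset_mset.le_diff_conv2)
    moreover have "p \<in> ?V" "q \<in> ?V"
      using completion_props(2)[OF fin I(1)] set_mset_mono[OF sub] by auto
    moreover have "0 < coeff E w (completion E I)"
      using I completion_props(3)[OF fin I(1), of w] by simp
    ultimately show ?thesis
      using completion_props(2)[OF fin I(1)] \<alpha>(1) unfolding L_def
      by (subst linked_iff[OF sizes \<alpha>(1)]) auto
  qed
  have L_two: "(p, q) \<in> L" if "good I" "p \<in># R I" "q \<in># R I" "p \<noteq> q" for p q I
    using that by (intro L_intro[of I]) (auto simp: subseteq_mset_def Suc_le_eq)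
  have L_path: "(p, q) \<in> L\<^sup>*" if "good I" "p \<in># R I" "q \<in># R I" for p q I
    using that L_two by (cases "p = q") auto
  have dom_elim: "\<exists>I. good I \<and> p \<in># R I" if "p \<in> Domain L" for p
  proof -
    from that obtain q where "(p, q) \<in> L" by blast
    then obtain \<gamma> where \<gamma>: "0 < coeff E w \<gamma>" "set_mset \<gamma> \<subseteq> ?V" "\<alpha> + {#p, q#} \<subseteq># \<gamma>"
      unfolding L_def by (subst (asm) linked_iff[OF sizes \<alpha>(1)]) auto
    obtain I where I: "I \<subseteq> E" "0 < w I" "\<gamma> = completion E I"
      using coeff_pos_imp_completion[OF fin \<gamma>(2,1)] by blast
    have "\<alpha> \<subseteq># \<gamma>" using \<gamma>(3) by (meson mset_subset_eq_add_left subset_mset.order_trans)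
    moreover have "p \<in># \<gamma> - \<alpha>"
    proof (rule mset_subset_eqD)
      show "{#p, q#} \<subseteq># \<gamma> - \<alpha>"
        unfolding subseteq_mset_def
      proof
        fix a
        have "count \<alpha> a + count {#p, q#} a \<le> count \<gamma> a"
          using mset_subset_eq_count[OF \<gamma>(3), of a] by (simp only: count_union)
        then show "count {#p, q#} a \<le> count (\<gamma> - \<alpha>) a" unfolding count_diff by linarith
      qed
    qed simp
    ultimately show ?thesis using I unfolding good_def R_def by blast
  qed
  have finI: "finite I" if "I \<subseteq> E" for I using that fin finite_subset by blast
  define C where "C = {a. Some a \<in># \<alpha>}"
  \<comment> \<open>A compatible set must leave enough copies of None for \<alpha>, so n' is the
    largest size allowed.\<close>
  define n' where "n' = card E - count \<alpha> None"
  \<comment> \<open>The good set J certifies that \<alpha> repeats no \<open>Some a\<close> and has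
    at most |E| copies of None; compatibility of I is then a matter of C and n'.\<close>
  have goodI: "good I" if "I \<subseteq> E" "0 < w I" "C \<subseteq> I" "card I \<le> n'" "good J" for I J
  proof -
    have J: "\<alpha> \<subseteq># completion E J" "J \<subseteq> E" using that by (auto simp: good_def)
    have "count \<alpha> z \<le> count (completion E I) z" for z
    proof (cases z)
      case None
      have "count \<alpha> None \<le> card E"
        using mset_subset_eq_count[OF J(1), of None] by (simp add: count_completion[OF finI[OF J(2)]])
      then show ?thesis using None that(4) by (simp add: count_completion[OF finI[OF that(1)]] n'_def)
    next
      case (Some a)
      have "count \<alpha> (Some a) \<le> 1"
        using mset_subset_eq_count[OF J(1), of "Some a"]
        by (simp add: count_completion[OF finI[OF J(2)]] split: if_splits)
      moreover have "count \<alpha> (Some a) = 0" if "a \<notin> I"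
        using that \<open>C \<subseteq> I\<close> by (auto simp: C_def not_in_iff[symmetric])
      ultimately show ?thesis using Some by (auto simp: count_completion[OF finI[OF that(1)]])
    qed
    then show ?thesis using that by (simp add: good_def subseteq_mset_def)
  qed
  have goodD: "I \<subseteq> E" "0 < w I" "C \<subseteq> I" "card I \<le> n'" if "good I" for I
  proof -
    show I: "I \<subseteq> E" "0 < w I" using that by (auto simp: good_def)
    have sub: "\<alpha> \<subseteq># completion E I" using that by (simp add: good_def)
    show "C \<subseteq> I"
      using mset_subset_eqD[OF sub] count_completion(1)[OF finI[OF I(1)], of E]
      by (auto simp: C_def) (metis count_greater_zero_iff less_irrefl)
    show "card I \<le> n'"
      using mset_subset_eq_count[OF sub, of None] card_mono[OF fin I(1)]
      by (simp add: count_completion[OF finI[OF I(1)]] n'_def)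
  qed
  have R_Some: "Some a \<in># R I \<longleftrightarrow> a \<in> I \<and> a \<notin> C" if "good I" for I a
  proof -
    have "count \<alpha> (Some a) \<le> count (completion E I) (Some a)"
      using that by (simp add: good_def mset_subset_eq_count)
    then have "0 < count (R I) (Some a) \<longleftrightarrow> a \<in> I \<and> count \<alpha> (Some a) = 0"
      by (auto simp: R_def count_completion[OF finI[OF goodD(1)[OF that]]])
    then show ?thesis by (simp add: C_def not_in_iff)
  qed
  have R_None: "None \<in># R I \<longleftrightarrow> card I < n'" if "good I" for I
  proof -
    have "0 < count (R I) None \<longleftrightarrow> card I < n'"
      using goodD(4)[OF that] by (auto simp: R_def n'_def count_completion[OF finI[OF goodD(1)[OF that]]])
    then show ?thesis by simp
  qed
  have R_size: "3 \<le> size (R I)" if "good I" for I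
    using that \<alpha>(2) completion_props(1)[OF fin goodD(1)[OF that]]
    by (auto simp: good_def R_def size_Diff_submset)
  \<comment> \<open>With |I| \<ge> n' - 1 the residue holds at most one None and at most one
    \<open>Some j\<close>, while three variables remain.\<close>
  have R_other: "\<exists>l. Some l \<in># R I \<and> l \<noteq> j" if I: "good I" "n' \<le> Suc (card I)" for I j
  proof (rule ccontr)
    assume no: "\<not> ?thesis"
    have "count (R I) None \<le> 1" using I(1,2) goodD[OF I(1)]
      by (auto simp: R_def n'_def count_completion[OF finI[OF goodD(1)[OF I(1)]]])
    moreover have "count (R I) (Some j) \<le> 1"
      by (simp add: R_def count_completion[OF finI[OF goodD(1)[OF I(1)]]])
    moreover have "R I = replicate_mset (count (R I) None) None + replicate_mset (count (R I) (Some j)) (Some j)"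
    proof (rule multiset_eqI)
      fix z show "count (R I) z = count (replicate_mset (count (R I) None) None
          + replicate_mset (count (R I) (Some j)) (Some j)) z"
        using no by (cases z) (auto simp: count_eq_zero_iff)
    qed
    then have "size (R I) = count (R I) None + count (R I) (Some j)"
      by (metis size_replicate_mset size_union)
    ultimately show False using R_size[OF I(1)] by linarith
  qed
  have pos: "0 < w A" "0 < w B" if "0 < w A * w B" for A B
    using that w[of A] w[of B] by (auto simp: zero_less_mult_iff)
  have to_None: "(Some i, None) \<in> L\<^sup>*" if A: "good I" "Some i \<in># R I" "good J" "None \<in># R J" for i I J
  proof (cases "None \<in># R I \<or> i \<in> J")
    case True
    then show ?thesis using A L_path R_Some by metis
  next
    case False
    note I = goodD[OF A(1)] and J = goodD[OF A(3)]
    have i: "i \<in> I" "i \<notin> J" "i \<notin> C" "i \<in> E" using A False R_Some I by auto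
    have cards: "card I = n'" "card J < n'" using False A R_None I by (auto simp: le_less)
    have "0 < w I * w J" using I J by simp
    then consider "0 < w (I - {i}) * w (insert i J)"
      | j where "j \<in> J - I" "0 < w (insert j (I - {i})) * w (insert i (J - {j}))"
      using exchangeD[OF ex I(1) J(1) i(1,2)] by (meson order.strict_trans2)
    then show ?thesis
    proof cases
      case 1
      have "card (insert i J) \<le> n'"
        using cards finI[OF J(1)] by (simp add: card_insert_if)
      then have g: "good (insert i J)"
        using i(4) J(1,3) pos(2)[OF 1] by (intro goodI[OF _ _ _ _ A(3)]) auto
      show ?thesis
      proof (cases "None \<in># R (insert i J)")
        case True
        then show ?thesis using g i R_Some by (intro L_path[OF g]) auto
      next
        case False
        \<comment> \<open>Adding i used up the last None of J, so \<open>R_other\<close> applies to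
          J and its variable l lies in both residues.\<close>
        then have "n' \<le> Suc (card J)" using R_None[OF g] i finI[OF J(1)] by auto
        then obtain l where l: "Some l \<in># R J" "l \<noteq> i"
          using R_other[OF A(3), of i] by blast
        then have "(Some i, Some l) \<in> L\<^sup>*" using g i R_Some[OF A(3)] R_Some[OF g] by (intro L_path[OF g]) auto
        moreover have "(Some l, None) \<in> L\<^sup>*" using l A by (intro L_path[OF A(3)])
        ultimately show ?thesis by (rule rtrancl_trans)
      qed
    next
      case (2 j)
      have "0 < card J" using 2(1) finI[OF J(1)] by (auto simp: card_gt_0_iff)
      then have c: "card (insert i (J - {j})) = card J"
        using 2(1) i(2) finI[OF J(1)] by simp
      have "C \<subseteq> insert i (J - {j})" using I(3) J(3) 2(1) by blast
      moreover have "card (insert i (J - {j})) \<le> n'" using c cards by simp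
      ultimately have g: "good (insert i (J - {j}))"
        using i(4) J(1) pos(2)[OF 2(2)] by (intro goodI[OF _ _ _ _ A(3)]) auto
      then have "None \<in># R (insert i (J - {j}))" using R_None c cards by simp
      then show ?thesis using g i R_Some by (intro L_path[OF g]) auto
    qed
  qed
  have no_None: "(Some i, Some j) \<in> L\<^sup>*"
    if none: "\<And>K. good K \<Longrightarrow> None \<notin># R K" and A: "good I" "Some i \<in># R I" "good J" "Some j \<in># R J" for i j I J
  proof (cases "i \<in> J")
    case True
    then show ?thesis using A R_Some by (intro L_path[of J]) auto
  next
    case False
    note I = goodD[OF A(1)] and J = goodD[OF A(3)]
    have i: "i \<in> I" "i \<notin> J" "i \<notin> C" "i \<in> E" using A False R_Some I by auto
    have cards: "card I = n'" "card J = n'" using A none R_None I J by (auto simp: le_less)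
    have "0 < w I * w J" using I J by simp
    then consider "0 < w (I - {i}) * w (insert i J)"
      | k where "k \<in> J - I" "0 < w (insert k (I - {i})) * w (insert i (J - {k}))"
      using exchangeD[OF ex I(1) J(1) i(1,2)] by (meson order.strict_trans2)
    then show ?thesis
    proof cases
      \<comment> \<open>Moving i alone would leave a good set with fewer than n' elements, whose
        residue contains None.\<close>
      case 1
      have less: "card (I - {i}) < n'"
        using i cards finI[OF I(1)] by (metis card_Diff1_less)
      have "C \<subseteq> I - {i}" using I(3) i(3) by blast
      then have "good (I - {i})"
        using less I(1) pos(1)[OF 1] by (intro goodI[OF _ _ _ _ A(1)]) auto
      then show ?thesis using none R_None less by blast
    next
      case (2 k)
      have "0 < card J" using 2(1) finI[OF J(1)] by (auto simp: card_gt_0_iff)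
      then have c: "card (insert i (J - {k})) = card J"
        using 2(1) i(2) finI[OF J(1)] by simp
      have "C \<subseteq> insert i (J - {k})" using I(3) J(3) 2(1) by blast
      moreover have "card (insert i (J - {k})) \<le> n'" using c cards by simp
      ultimately have g: "good (insert i (J - {k}))"
        using i(4) J(1) pos(2)[OF 2(2)] by (intro goodI[OF _ _ _ _ A(3)]) auto
      obtain l where l: "Some l \<in># R J" "l \<noteq> k"
        using R_other[OF A(3), of k] cards by auto
      have "(Some i, Some l) \<in> L\<^sup>*"
        using g i l R_Some[OF A(3)] R_Some[OF g] by (intro L_path[OF g]) auto
      moreover have "(Some l, Some j) \<in> L\<^sup>*" using l A by (intro L_path[OF A(3)])
      ultimately show ?thesis by (rule rtrancl_trans)
    qed
  qed
  have sym: "(p, q) \<in> L\<^sup>* \<Longrightarrow> (q, p) \<in> L\<^sup>*" for p q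
    unfolding L_def by (rule linked_rtrancl_sym)
  obtain I J where IJ: "good I" "x \<in># R I" "good J" "y \<in># R J"
    using dom dom_elim unfolding L_def[symmetric] by blast
  have "(x, y) \<in> L\<^sup>*"
  proof (cases "\<exists>K. good K \<and> None \<in># R K")
    case True
    then obtain K where K: "good K" "None \<in># R K" by blast
    have "(x, None) \<in> L\<^sup>*" using to_None[OF IJ(1) _ K] IJ(2) by (cases x) auto
    moreover have "(y, None) \<in> L\<^sup>*" using to_None[OF IJ(3) _ K] IJ(4) by (cases y) auto
    ultimately show ?thesis using sym by (meson rtrancl_trans)
  next
    case False
    then have none: "None \<notin># R K" if "good K" for K using that by blast
    then obtain i j where "x = Some i" "y = Some j" using IJ by (metis not_None_eq)
    then show ?thesis using no_None[OF none] IJ by blast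
  qed
  then show ?thesis by (simp add: L_def)
qed

subsection \<open>Products of two generating polynomials\<close>

definition side :: "bool \<Rightarrow> (bool \<times> 'v) multiset \<Rightarrow> 'v multiset" where
  "side b \<alpha> = image_mset snd (filter_mset (\<lambda>p. fst p = b) \<alpha>)"

lemma side_simps [simp]:
  "side b {#} = {#}"
  "side b (add_mset p \<alpha>) = (if fst p = b then add_mset (snd p) (side b \<alpha>) else side b \<alpha>)"
  "side b (\<alpha> + \<beta>) = side b \<alpha> + side b \<beta>"
  "side b (image_mset (Pair b') \<gamma>) = (if b = b' then \<gamma> else {#})"
  by (auto simp: side_def filter_mset_image_mset multiset.map_comp comp_def)

lemma side_decomposition:
  "image_mset (Pair b) (side b \<alpha>) + image_mset (Pair (\<not> b)) (side (\<not> b) \<alpha>) = \<alpha>"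
proof (induction \<alpha>)
  case (add p \<alpha>)
  then show ?case by (cases p; cases "fst p = b") auto
qed simp

lemma size_sides: "size (side b \<alpha>) + size (side (\<not> b) \<alpha>) = size \<alpha>"
  by (metis side_decomposition size_image_mset size_union)

lemma side_mono: "\<alpha> \<subseteq># \<gamma> \<Longrightarrow> side b \<alpha> \<subseteq># side b \<gamma>"
  unfolding side_def by (intro image_mset_subseteq_mono multiset_filter_mono)

lemma set_side: "set_mset \<alpha> \<subseteq> UNIV \<times> V \<Longrightarrow> set_mset (side b \<alpha>) \<subseteq> V"
  by (auto simp: side_def)

text \<open>The product of two such polynomials in disjoint sets of variables, tagged by a boolean.\<close>

definition coeff2 :: "'e set \<Rightarrow> (bool \<Rightarrow> 'e set \<Rightarrow> real) \<Rightarrow> (bool \<times> 'e option) multiset \<Rightarrow> real" where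
  "coeff2 E W \<alpha> = coeff E (W True) (side True \<alpha>) * coeff E (W False) (side False \<alpha>)"

lemma coeff2_eq: "coeff2 E W \<alpha> = coeff E (W b) (side b \<alpha>) * coeff E (W (\<not> b)) (side (\<not> b) \<alpha>)"
  by (cases b) (simp_all add: coeff2_def)

lemma coeff_size: "coeff E w \<beta> \<noteq> 0 \<Longrightarrow> size \<beta> = card E"
  by (auto simp: coeff_def split: if_splits)

lemma coeff2_size: "coeff2 E W \<alpha> \<noteq> 0 \<Longrightarrow> size (side b \<alpha>) = card E"
  unfolding coeff2_eq[of E W \<alpha> b] by (auto dest: coeff_size)

lemma coeff2_total_size: "coeff2 E W \<alpha> \<noteq> 0 \<Longrightarrow> size \<alpha> = 2 * card E"
  using coeff2_size[of E W \<alpha> True] coeff2_size[of E W \<alpha> False] size_sides[of True \<alpha>] by simp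

lemma lorentzian_image_Pair:
  assumes "lorentzian V A"
  shows "lorentzian (Pair b ` V) (\<lambda>p q. A (snd p) (snd q))"
proof -
  have "bform (Pair b ` V) (\<lambda>p q. A (snd p) (snd q)) x y = bform V A (\<lambda>i. x (b, i)) (\<lambda>i. y (b, i))"
    for x y
    unfolding bform_def by (simp add: sum.reindex inj_on_def)
  then show ?thesis using assms by (simp add: lorentzian_def)
qed

text \<open>The quadratic form is twice a product of two linear forms, for which the reversed
  Cauchy--Schwarz inequality has the deficit (p s - q r)^2.\<close>

lemma lorentzian_bipartite:
  fixes u :: "bool \<Rightarrow> 'v \<Rightarrow> real"
  shows "lorentzian (UNIV \<times> V) (\<lambda>p q. if fst p = fst q then 0 else u (fst p) (snd p) * u (fst q) (snd q))"
    (is "lorentzian ?V ?M")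
proof -
  define X where "X = (\<lambda>b x. \<Sum>i\<in>V. u b i * x (b, i) :: real)"
  have sum_V: "(\<Sum>p\<in>?V. f p) = (\<Sum>i\<in>V. f (True, i)) + (\<Sum>i\<in>V. f (False, i))" for f :: "_ \<Rightarrow> real"
    by (simp add: sum.cartesian_product[symmetric, of "\<lambda>b i. f (b, i)", simplified] UNIV_bool)
  have "bform ?V ?M x y = X True x * X False y + X False x * X True y" for x y
    unfolding bform_def sum_V X_def sum_product by (simp add: mult_ac)
  moreover have "(p * q + q * p) * (r * s + s * r) \<le> (p * s + q * r)\<^sup>2" for p q r s :: real
  proof -
    have "(p * s + q * r)\<^sup>2 - (p * q + q * p) * (r * s + s * r) = (p * s - q * r)\<^sup>2"
      by (simp add: power2_eq_square algebra_simps)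
    then show ?thesis using zero_le_power2[of "p * s - q * r"] by linarith
  qed
  ultimately show ?thesis by (simp only: lorentzian_def) blast
qed

text \<open>Both factors have degree n, so 2 n - 2 derivatives leave something nonzero only when
  split as n and n - 2, where one factor is a nonnegative constant, or as n - 1 and n - 1, where two
  linear forms are multiplied.\<close>

lemma lorentzian_coeff2:
  assumes fin: "finite E" and n: "2 \<le> card E"
    and ex: "\<And>b. exchange E (W b)" and w: "\<And>b I. 0 \<le> W b I"
    and \<alpha>: "size \<alpha> = 2 * card E - 2" "set_mset \<alpha> \<subseteq> UNIV \<times> insert None (Some ` E)"
  shows "lorentzian (UNIV \<times> insert None (Some ` E)) (\<lambda>p q. coeff2 E W (\<alpha> + {#p, q#}))"
proof -
  let ?V = "insert None (Some ` E)"
  consider b where "size (side b \<alpha>) = card E" | "\<forall>b. size (side b \<alpha>) = card E - 1"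
    | "\<forall>b. size (side b \<alpha>) \<noteq> card E" "\<not> (\<forall>b. size (side b \<alpha>) = card E - 1)" by blast
  then show ?thesis
  proof cases
    case (1 b)
    have sz: "size (side (\<not> b) \<alpha>) + 2 = card E"
      using size_sides[of b \<alpha>] 1 \<alpha>(1) n by simp
    let ?A = "\<lambda>x y. coeff E (W (\<not> b)) (side (\<not> b) \<alpha> + {#x, y#})"
    show ?thesis
    proof (rule lorentzian_superset[where V = "Pair (\<not> b) ` ?V"])
      have "lorentzian ?V ?A"
        using lorentzian_coeff[OF fin ex w sz set_side[OF \<alpha>(2)]] .
      then have "lorentzian (Pair (\<not> b) ` ?V)
          (\<lambda>p q. coeff E (W b) (side b \<alpha>) * ?A (snd p) (snd q))"
        using coeff_nonneg[of "W b"] w by (intro lorentzian_scale lorentzian_image_Pair) auto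
      then show "lorentzian (Pair (\<not> b) ` ?V) (\<lambda>p q. coeff2 E W (\<alpha> + {#p, q#}))"
        by (subst lorentzian_cong[where N = "\<lambda>p q. coeff E (W b) (side b \<alpha>) * ?A (snd p) (snd q)"])
           (auto simp: coeff2_eq[of _ _ _ b])
    next
      fix p q :: "bool \<times> 'a option"
      assume "p \<in> UNIV \<times> ?V" "q \<in> UNIV \<times> ?V" "p \<notin> Pair (\<not> b) ` ?V \<or> q \<notin> Pair (\<not> b) ` ?V"
      then have "fst p = b \<or> fst q = b" by (cases p; cases q) auto
      then have "size (side b (\<alpha> + {#p, q#})) \<noteq> card E" using 1 by auto
      then show "coeff2 E W (\<alpha> + {#p, q#}) = 0" using coeff2_size by blast
    qed (use fin in auto)
  next
    case 2
    define u where "u = (\<lambda>b x. coeff E (W b) (add_mset x (side b \<alpha>)))"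
    have "coeff2 E W (\<alpha> + {#p, q#}) = (if fst p = fst q then 0 else u (fst p) (snd p) * u (fst q) (snd q))"
      for p q
    proof (cases "fst p = fst q")
      case True
      have "size (side (fst p) (\<alpha> + {#p, q#})) \<noteq> card E" using True 2 n by simp
      then show ?thesis using True coeff2_size by metis
    next
      case False
      then have "fst q = (\<not> fst p)" by auto
      then show ?thesis by (simp add: coeff2_eq[of _ _ _ "fst p"] u_def)
    qed
    then show ?thesis by (simp only: lorentzian_bipartite)
  next
    case 3
    have "coeff2 E W (\<alpha> + {#p, q#}) = 0" for p q
    proof (rule ccontr)
      assume "coeff2 E W (\<alpha> + {#p, q#}) \<noteq> 0"
      then have sz: "size (side b (\<alpha> + {#p, q#})) = card E" for b by (rule coeff2_size)
      show False
      proof (cases "fst p = fst q")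
        case True
        then show False using sz[of "\<not> fst p"] 3(1) by simp
      next
        case False
        then have "size (side b \<alpha>) = card E - 1" for b
          using sz[of b] by (cases "fst p = b"; cases "fst q = b") auto
        then show False using 3(2) by blast
      qed
    qed
    then show ?thesis by (simp add: lorentzian_zero)
  qed
qed

section \<open>Connectedness of the support graph of the product\<close>

definition completable :: "'e set \<Rightarrow> ('e set \<Rightarrow> real) \<Rightarrow> 'e option multiset \<Rightarrow> bool" where
  "completable E w \<beta> \<longleftrightarrow>
     (\<exists>\<gamma>. 0 < coeff E w \<gamma> \<and> set_mset \<gamma> \<subseteq> insert None (Some ` E) \<and> \<beta> \<subseteq># \<gamma>)"

lemma completable_mono: "completable E w \<gamma> \<Longrightarrow> \<beta> \<subseteq># \<gamma> \<Longrightarrow> completable E w \<beta>"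
  unfolding completable_def using subset_mset.order_trans by blast

lemma completable_size: "completable E w \<beta> \<Longrightarrow> size \<beta> \<le> card E"
  unfolding completable_def by (metis coeff_size less_irrefl size_mset_mono)

lemma completable_extend:
  assumes "completable E w \<beta>" "size \<beta> < card E"
  obtains x where "x \<in> insert None (Some ` E)" "completable E w (add_mset x \<beta>)"
proof -
  obtain \<gamma> where \<gamma>: "0 < coeff E w \<gamma>" "set_mset \<gamma> \<subseteq> insert None (Some ` E)" "\<beta> \<subseteq># \<gamma>"
    using assms(1) by (auto simp: completable_def)
  have "size \<gamma> = card E" using \<gamma>(1) by (intro coeff_size[of E w]) simp
  then have "\<gamma> - \<beta> \<noteq> {#}" using assms(2) \<gamma>(3)
    by (metis less_irrefl subset_mset.diff_add add_0)
  then obtain x where x: "x \<in># \<gamma> - \<beta>" by blast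
  then have "{#x#} \<subseteq># \<gamma> - \<beta>" by simp
  then have "{#x#} + \<beta> \<subseteq># \<gamma> - \<beta> + \<beta>" by (rule subset_mset.add_right_mono)
  then have "add_mset x \<beta> \<subseteq># \<gamma>" using \<gamma>(3) by simp
  moreover have "x \<in> insert None (Some ` E)" using x \<gamma>(2) by (meson in_diffD subsetD)
  ultimately show thesis using that \<gamma> by (auto simp: completable_def)
qed

text \<open>The factors use disjoint variables, so the monomials of the product are arbitrary pairs
  of monomials and the condition for an edge decouples into the two sides.\<close>

lemma linked_coeff2_iff:
  assumes w: "\<And>b I. 0 \<le> W b I" and n: "1 \<le> card E"
    and \<alpha>: "set_mset \<alpha> \<subseteq> UNIV \<times> insert None (Some ` E)"
  shows "(p, q) \<in> linked (UNIV \<times> insert None (Some ` E)) (2 * card E - 2) (coeff2 E W) \<alpha> \<longleftrightarrow>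
    snd p \<in> insert None (Some ` E) \<and> snd q \<in> insert None (Some ` E) \<and>
    (\<forall>b. completable E (W b) (side b (\<alpha> + {#p, q#})))"
proof -
  let ?V = "insert None (Some ` E)"
  have sizes: "coeff2 E W \<gamma> \<noteq> 0 \<Longrightarrow> size \<gamma> = 2 * card E - 2 + 2" for \<gamma>
    using n coeff2_total_size[of E W \<gamma>] by simp
  have nn: "0 \<le> coeff E (W b) \<gamma>" for b \<gamma> using w by (rule coeff_nonneg)
  have ex: "(\<exists>\<gamma>. 0 < coeff2 E W \<gamma> \<and> set_mset \<gamma> \<subseteq> UNIV \<times> ?V \<and> \<alpha> + {#p, q#} \<subseteq># \<gamma>) \<longleftrightarrow>
      (\<forall>b. completable E (W b) (side b (\<alpha> + {#p, q#})))"
  proof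
    assume "\<exists>\<gamma>. 0 < coeff2 E W \<gamma> \<and> set_mset \<gamma> \<subseteq> UNIV \<times> ?V \<and> \<alpha> + {#p, q#} \<subseteq># \<gamma>"
    then obtain \<gamma> where \<gamma>: "0 < coeff2 E W \<gamma>" "set_mset \<gamma> \<subseteq> UNIV \<times> ?V" "\<alpha> + {#p, q#} \<subseteq># \<gamma>" by blast
    show "\<forall>b. completable E (W b) (side b (\<alpha> + {#p, q#}))"
    proof
      fix b
      have "coeff E (W b) (side b \<gamma>) \<noteq> 0" using \<gamma>(1) unfolding coeff2_eq[of _ _ _ b] by auto
      then have "0 < coeff E (W b) (side b \<gamma>)" using nn[of b "side b \<gamma>"] by simp
      then show "completable E (W b) (side b (\<alpha> + {#p, q#}))"
        unfolding completable_def using set_side[OF \<gamma>(2)] side_mono[OF \<gamma>(3)] by blast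
    qed
  next
    assume "\<forall>b. completable E (W b) (side b (\<alpha> + {#p, q#}))"
    then obtain \<Gamma> where \<Gamma>: "\<And>b. 0 < coeff E (W b) (\<Gamma> b)" "\<And>b. set_mset (\<Gamma> b) \<subseteq> ?V"
      "\<And>b. side b (\<alpha> + {#p, q#}) \<subseteq># \<Gamma> b"
      unfolding completable_def by metis
    define \<gamma> where "\<gamma> = image_mset (Pair True) (\<Gamma> True) + image_mset (Pair False) (\<Gamma> False)"
    have "image_mset (Pair True) (side True (\<alpha> + {#p, q#}))
        + image_mset (Pair (\<not> True)) (side (\<not> True) (\<alpha> + {#p, q#})) \<subseteq># \<gamma>"
      unfolding \<gamma>_def not_True_eq_False
      by (intro subset_mset.add_mono image_mset_subseteq_mono \<Gamma>(3))
    then have "\<alpha> + {#p, q#} \<subseteq># \<gamma>" by (simp only: side_decomposition)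
    moreover have "0 < coeff2 E W \<gamma>" using \<Gamma>(1) by (simp add: coeff2_def \<gamma>_def)
    moreover have "set_mset \<gamma> \<subseteq> UNIV \<times> ?V" using \<Gamma>(2) by (auto simp: \<gamma>_def)
    ultimately show "\<exists>\<gamma>. 0 < coeff2 E W \<gamma> \<and> set_mset \<gamma> \<subseteq> UNIV \<times> ?V \<and> \<alpha> + {#p, q#} \<subseteq># \<gamma>"
      by blast
  qed
  have mem: "r \<in> UNIV \<times> ?V \<longleftrightarrow> snd r \<in> ?V" for r :: "bool \<times> 'a option"
    by (cases r) simp
  have "(p, q) \<in> linked (UNIV \<times> ?V) (2 * card E - 2) (coeff2 E W) \<alpha> \<longleftrightarrow>
      p \<in> UNIV \<times> ?V \<and> q \<in> UNIV \<times> ?V \<and>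
      (\<exists>\<gamma>. 0 < coeff2 E W \<gamma> \<and> set_mset \<gamma> \<subseteq> UNIV \<times> ?V \<and> \<alpha> + {#p, q#} \<subseteq># \<gamma>)"
    using sizes \<alpha> by (rule linked_iff)
  then show ?thesis unfolding ex mem .
qed

text \<open>While both sides can still be differentiated, any vertex of one side is adjacent to any
  vertex of the other, and two vertices of the same side meet in a vertex opposite. Once a side is
  full, the graph is that of the other factor alone.\<close>

lemma linked_coeff2_connected:
  fixes W :: "bool \<Rightarrow> 'e set \<Rightarrow> real"
  assumes fin: "finite E" and ex: "\<And>b. exchange E (W b)" and w: "\<And>b I. 0 \<le> W b I"
    and \<alpha>: "size \<alpha> < 2 * card E - 2" "set_mset \<alpha> \<subseteq> UNIV \<times> insert None (Some ` E)"
    and dom: "p \<in> Domain (linked (UNIV \<times> insert None (Some ` E)) (2 * card E - 2) (coeff2 E W) \<alpha>)"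
      "q \<in> Domain (linked (UNIV \<times> insert None (Some ` E)) (2 * card E - 2) (coeff2 E W) \<alpha>)"
  shows "(p, q) \<in> (linked (UNIV \<times> insert None (Some ` E)) (2 * card E - 2) (coeff2 E W) \<alpha>)\<^sup>*"
proof -
  let ?V = "insert None (Some ` E)"
  define L where "L = linked (UNIV \<times> ?V) (2 * card E - 2) (coeff2 E W) \<alpha>"
  have n: "1 \<le> card E" using \<alpha>(1) by simp
  have L_iff: "(r, s) \<in> L \<longleftrightarrow> snd r \<in> ?V \<and> snd s \<in> ?V \<and>
      (\<forall>b. completable E (W b) (side b (\<alpha> + {#r, s#})))" for r s
    unfolding L_def by (rule linked_coeff2_iff[OF w n \<alpha>(2)])
  have dom_L: "snd r \<in> ?V \<and> completable E (W (fst r)) (add_mset (snd r) (side (fst r) \<alpha>))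
      \<and> (\<forall>b. completable E (W b) (side b \<alpha>))" if r: "r \<in> Domain L" for r
  proof -
    obtain s where s: "(r, s) \<in> L" using r by blast
    then have c: "completable E (W b) (side b (\<alpha> + {#r, s#}))" for b by (simp add: L_iff)
    have "side b \<alpha> \<subseteq># side b (\<alpha> + {#r, s#})" for b by (rule side_mono) simp
    moreover have "add_mset (snd r) (side (fst r) \<alpha>) \<subseteq># side (fst r) (\<alpha> + {#r, s#})"
      using side_mono[of "add_mset r \<alpha>" "\<alpha> + {#r, s#}" "fst r"] by simp
    ultimately show ?thesis using s c completable_mono unfolding L_iff by blast
  qed
  have "(p, q) \<in> L\<^sup>*"
  proof (cases "\<forall>b. size (side b \<alpha>) < card E")
    case True
    have direct: "(r, s) \<in> L" if "fst s = (\<not> fst r)" "snd r \<in> ?V" "snd s \<in> ?V"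
      "completable E (W (fst r)) (add_mset (snd r) (side (fst r) \<alpha>))"
      "completable E (W (fst s)) (add_mset (snd s) (side (fst s) \<alpha>))" for r s
    proof -
      have "completable E (W b) (side b (\<alpha> + {#r, s#}))" for b
        using that by (cases "b = fst r") auto
      then show ?thesis using that by (simp add: L_iff)
    qed
    have dp: "snd p \<in> ?V" "completable E (W (fst p)) (add_mset (snd p) (side (fst p) \<alpha>))"
      and dq: "snd q \<in> ?V" "completable E (W (fst q)) (add_mset (snd q) (side (fst q) \<alpha>))"
      and c: "\<And>b. completable E (W b) (side b \<alpha>)"
      using dom dom_L unfolding L_def[symmetric] by blast+
    show ?thesis
    proof (cases "fst p = fst q")
      case False
      then show ?thesis using direct[of q p] dp dq by (intro r_into_rtrancl direct) auto
    next
      case same: True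
      obtain y where y: "y \<in> ?V" "completable E (W (\<not> fst p)) (add_mset y (side (\<not> fst p) \<alpha>))"
        using completable_extend[OF c, of "\<not> fst p"] True by blast
      have "(p, (\<not> fst p, y)) \<in> L" using dp y by (intro direct) auto
      moreover have "((\<not> fst p, y), q) \<in> L" using dq y same by (intro direct) auto
      ultimately show ?thesis by (meson r_into_rtrancl rtrancl_trans)
    qed
  next
    case False
    then obtain b where b: "card E \<le> size (side b \<alpha>)" by (auto simp: not_less)
    let ?b = "\<not> b"
    have c: "completable E (W b) (side b \<alpha>)" using dom dom_L unfolding L_def[symmetric] by blast
    \<comment> \<open>The full side is completable and hence has size exactly |E|; the bound on
      \<alpha> then leaves at least three derivatives for the other side.\<close>
    have sz: "size (side ?b \<alpha>) + 3 \<le> card E"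
      using \<alpha>(1) b size_sides[of b \<alpha>] completable_size[OF c] by linarith
    define L0 where "L0 = linked ?V (card E - 2) (coeff E (W ?b)) (side ?b \<alpha>)"
    have sizes: "coeff E (W ?b) \<gamma> \<noteq> 0 \<Longrightarrow> size \<gamma> = card E - 2 + 2" for \<gamma>
      using sz coeff_size[of E "W ?b" \<gamma>] by simp
    have L0_iff: "(x, y) \<in> L0 \<longleftrightarrow> x \<in> ?V \<and> y \<in> ?V \<and>
        completable E (W ?b) (side ?b \<alpha> + {#x, y#})" for x y
      unfolding L0_def completable_def
      by (rule linked_iff[OF sizes set_side[OF \<alpha>(2)]])
    have lift: "((?b, x), (?b, y)) \<in> L" if "(x, y) \<in> L0" for x y
    proof -
      have "completable E (W b') (side b' (\<alpha> + {#(?b, x), (?b, y)#}))" for b'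
        using that c by (cases "b' = b") (auto simp: L0_iff)
      then show ?thesis using that by (simp add: L_iff L0_iff)
    qed
    have lift_path: "((?b, x), (?b, y)) \<in> L\<^sup>*" if "(x, y) \<in> L0\<^sup>*" for x y
      using that by induction (auto intro: rtrancl_into_rtrancl lift)
    have fst_b: "fst r = ?b" if "completable E (W (fst r)) (add_mset (snd r) (side (fst r) \<alpha>))" for r
    proof (rule ccontr)
      assume "fst r \<noteq> ?b"
      then show False using completable_size[OF that] b by simp
    qed
    have dom0: "r = (?b, snd r) \<and> snd r \<in> Domain L0" if r: "r \<in> Domain L" for r
    proof -
      obtain s where s: "(r, s) \<in> L" using r by blast
      then have "(s, r) \<in> L" unfolding L_def by (rule linked_sym)
      then have "fst s = ?b" using dom_L[of s] fst_b by blast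
      moreover have "fst r = ?b" using dom_L[OF r] fst_b by blast
      ultimately have "(snd r, snd s) \<in> L0"
        using s unfolding L0_iff L_iff by (cases r; cases s) (auto dest: spec[of _ ?b])
      then show ?thesis using \<open>fst r = ?b\<close> by (cases r) auto
    qed
    have "(snd p, snd q) \<in> L0\<^sup>*"
      using dom dom0 sz unfolding L_def[symmetric] L0_def
      by (intro linked_coeff_connected[OF fin ex w set_side[OF \<alpha>(2)]]) blast+
    then show ?thesis using lift_path dom dom0 unfolding L_def[symmetric] by metis
  qed
  then show ?thesis by (simp add: L_def)
qed


subsection \<open>Evaluation of the mixed derivatives\<close>

lemma derivs_append: "derivs V (us @ vs) c \<alpha> = derivs V us (derivs V vs c) \<alpha>"
  by (induction us arbitrary: \<alpha>) simp_all

definition unit_vec :: "'v \<Rightarrow> 'v \<Rightarrow> real" where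
  "unit_vec p = (\<lambda>q. if q = p then 1 else 0)"

lemma sum_unit_vec:
  assumes "finite V" "p \<in> V"
  shows "(\<Sum>i\<in>V. unit_vec p i * f i) = f p"
proof -
  have "(\<Sum>i\<in>V. unit_vec p i * f i) = (\<Sum>i\<in>V. if i = p then f i else 0)"
    by (intro sum.cong refl) (simp add: unit_vec_def)
  then show ?thesis using assms by simp
qed

lemma derivs_replicate:
  assumes "finite V" "p \<in> V"
  shows "derivs V (replicate k (unit_vec p)) c \<alpha> = c (replicate_mset k p + \<alpha>)"
  by (induction k arbitrary: \<alpha>) (simp_all add: sum_unit_vec[OF assms])

definition split_mset :: "'e set \<Rightarrow> 'e set \<Rightarrow> (bool \<times> 'e option) multiset" where
  "split_mset X S = image_mset (\<lambda>e. (True, Some e)) (mset_set S)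
     + image_mset (\<lambda>e. (False, Some e)) (mset_set (X - S))"

text \<open>Expanding the product of two-term operators: S collects the elements differentiated in
  the first factor, the others go to the second.\<close>

lemma derivs_split:
  assumes "finite V" "distinct es" "\<And>e b. e \<in> set es \<Longrightarrow> (b, Some e) \<in> V"
  shows "derivs V (map (\<lambda>e p. unit_vec (True, Some e) p + unit_vec (False, Some e) p) es) c \<alpha>
    = (\<Sum>S\<in>Pow (set es). c (split_mset (set es) S + \<alpha>))"
  using assms(2,3)
proof (induction es arbitrary: \<alpha>)
  case Nil
  then show ?case by (simp add: split_mset_def)
next
  case (Cons e es)
  let ?X = "set es"
  have e: "e \<notin> ?X" using Cons.prems by simp
  have in_V: "(b, Some e) \<in> V" for b using Cons.prems by simp
  have IH: "derivs V (map (\<lambda>e p. unit_vec (True, Some e) p + unit_vec (False, Some e) p) es) c \<beta>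
      = (\<Sum>S\<in>Pow ?X. c (split_mset ?X S + \<beta>))" for \<beta>
    using Cons.prems by (intro Cons.IH) auto
  have in1: "split_mset (insert e ?X) (insert e S) + \<alpha> = split_mset ?X S + add_mset (True, Some e) \<alpha>"
    if "S \<in> Pow ?X" for S
  proof -
    have "finite S" "e \<notin> S" "insert e ?X - insert e S = ?X - S"
      using that e by (auto intro: finite_subset)
    then show ?thesis by (simp add: split_mset_def)
  qed
  have in2: "split_mset (insert e ?X) S + \<alpha> = split_mset ?X S + add_mset (False, Some e) \<alpha>"
    if "S \<in> Pow ?X" for S
  proof -
    have "insert e ?X - S = insert e (?X - S)" "e \<notin> ?X - S"
      using that e by auto
    then show ?thesis by (simp add: split_mset_def)
  qed
  have inj: "inj_on (insert e) (Pow ?X)"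
    using e by (auto simp: inj_on_def)
  have "Pow (set (e # es)) = Pow ?X \<union> insert e ` Pow ?X" by (simp add: Pow_insert)
  then have "(\<Sum>S\<in>Pow (set (e # es)). c (split_mset (set (e # es)) S + \<alpha>))
      = (\<Sum>S\<in>Pow ?X. c (split_mset (insert e ?X) S + \<alpha>))
        + (\<Sum>S\<in>Pow ?X. c (split_mset (insert e ?X) (insert e S) + \<alpha>))"
    using e by (simp only: list.set) (subst sum.union_disjoint, auto simp: sum.reindex[OF inj])
  also have "\<dots> = (\<Sum>S\<in>Pow ?X. c (split_mset ?X S + add_mset (True, Some e) \<alpha>))
        + (\<Sum>S\<in>Pow ?X. c (split_mset ?X S + add_mset (False, Some e) \<alpha>))"
    using in1 in2 by (simp add: add.commute)
  finally show ?case
    by (simp add: distrib_right sum.distrib sum_unit_vec[OF assms(1) in_V] IH)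
qed

lemma coeff_subset_plus_None:
  assumes "finite E" "S \<subseteq> E"
  shows "coeff E w (image_mset Some (mset_set S) + replicate_mset k None)
    = (if card S + k = card E then w S * fact k else 0)"
proof -
  have fin: "finite S" using assms finite_subset by blast
  have eq: "image_mset Some (mset_set S) = mset_set (Some ` S)"
    by (simp add: image_mset_mset_set)
  have "{a. Some a \<in># mset_set (Some ` S) + replicate_mset k None} = S" using fin by auto
  then show ?thesis using fin
    unfolding coeff_def eq by (auto simp: count_mset_set' card_image)
qed

theorem common_weight_ultra_log_concave:
  fixes w1 w2 :: "'e set \<Rightarrow> real"
  assumes fin: "finite E" and ex: "exchange E w1" "exchange E w2"
    and w: "\<And>I. 0 \<le> w1 I" "\<And>I. 0 \<le> w2 I" and k: "k + 2 \<le> card E"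
  defines "Z \<equiv> \<lambda>k. \<Sum>I\<in>{I. I \<subseteq> E \<and> card I = k}. w1 I * w2 I"
  shows "Z k / real (card E choose k) * (Z (k + 2) / real (card E choose (k + 2)))
    \<le> (Z (k + 1) / real (card E choose (k + 1)))\<^sup>2"
proof -
  define n where "n = card E"
  \<comment> \<open>The complement undoes the one in \<open>split_mset\<close>: the second factor
    receives E - S and evaluates w2 at S.\<close>
  define W where "W = (\<lambda>b. if b then w1 else (\<lambda>I. w2 (E - I)))"
  define V where "V = (UNIV :: bool set) \<times> insert None (Some ` E)"
  have exW: "exchange E (W b)" for b
    using ex(1) exchange_complement[OF ex(2)] by (simp add: W_def)
  have W0: "0 \<le> W b I" for b I using w by (simp add: W_def)
  have V: "finite V" "(b, None) \<in> V" for b using fin by (auto simp: V_def)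
  obtain es where es: "set es = E" "distinct es" using finite_distinct_list[OF fin] by blast
  define K where "K = (\<lambda>p q. \<Sum>S\<in>Pow E. coeff2 E W
      (split_mset E S + (replicate_mset p (True, None) + replicate_mset q (False, None))))"
  \<comment> \<open>The first factor requires |S| + p = n and the second |E - S| + q = n; for p + q
    = n both say |S| = q. The factorials come from the powers of y and z.\<close>
  have K: "K p q = fact p * fact q * Z q" if pq: "p + q = n" for p q
  proof -
    have "coeff2 E W (split_mset E S + (replicate_mset p (True, None) + replicate_mset q (False, None)))
        = (if card S = q then fact p * fact q * (w1 S * w2 S) else 0)" if S: "S \<in> Pow E" for S
    proof -
      have side_repl: "side b (replicate_mset m (b', None)) = (if b = b' then replicate_mset m None else {#})"
        for b b' m
        by (induction m) auto
      have side_img: "side b (image_mset (\<lambda>e. (b', Some e)) A) = (if b = b' then image_mset Some A else {#})"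
        for b b' and A :: "'e multiset"
        by (induction A) auto
      have "coeff2 E W (split_mset E S + (replicate_mset p (True, None) + replicate_mset q (False, None)))
          = coeff E w1 (image_mset Some (mset_set S) + replicate_mset p None)
            * coeff E (\<lambda>I. w2 (E - I)) (image_mset Some (mset_set (E - S)) + replicate_mset q None)"
        by (simp add: coeff2_def W_def split_mset_def side_img side_repl)
      moreover have "card (E - S) = n - card S" "card S \<le> n" "E - (E - S) = S"
        using S fin by (auto simp: n_def card_Diff_subset finite_subset card_mono)
      ultimately show ?thesis
        using S fin pq by (auto simp: coeff_subset_plus_None n_def)
    qed
    then have "K p q = (\<Sum>S\<in>Pow E. if card S = q then fact p * fact q * (w1 S * w2 S) else 0)"
      by (simp add: K_def)
    also have "\<dots> = (\<Sum>S\<in>{S. S \<subseteq> E \<and> card S = q}. fact p * fact q * (w1 S * w2 S))"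
      using fin by (intro sum.mono_neutral_cong_right) auto
    finally show ?thesis by (simp add: Z_def sum_distrib_left)
  qed
  define a where "a = n - 2 - k"
  have ak: "a + k + 2 = n" using k by (simp add: a_def n_def)
  \<comment> \<open>Together 2 n - 2 directions: one for each element of E, a along y and k along z.
    The last two derivatives, yy, yz or zz, bring the order in z to k, k + 1 or k + 2.\<close>
  define vs where "vs = replicate a (unit_vec (True, None)) @ replicate k (unit_vec (False, None))
    @ map (\<lambda>e p. unit_vec (True, Some e) p + unit_vec (False, Some e) p) es"
  have eval: "derivs V vs (coeff2 E W) \<alpha>
      = (\<Sum>S\<in>Pow E. coeff2 E W (split_mset E S
          + (replicate_mset k (False, None) + (replicate_mset a (True, None) + \<alpha>))))" for \<alpha>
    unfolding vs_def derivs_append derivs_replicate[OF V(1) V(2)]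
    using derivs_split[OF V(1) es(2)] es(1) by (simp add: V_def)
  have "length vs = 2 * n - 2"
    using ak es distinct_card[OF es(2)] by (simp add: vs_def n_def)
  then have "derivs V vs (coeff2 E W) {#(True, None), (True, None)#}
      * derivs V vs (coeff2 E W) {#(False, None), (False, None)#}
    \<le> (derivs V vs (coeff2 E W) {#(True, None), (False, None)#})\<^sup>2"
  proof (intro lorentzian_local_to_global[OF V(1)])
    show "0 \<le> coeff2 E W \<alpha>" for \<alpha>
      unfolding coeff2_def using W0 by (intro mult_nonneg_nonneg coeff_nonneg)
    show "lorentzian V (\<lambda>i j. coeff2 E W (\<alpha> + {#i, j#}))"
      if "size \<alpha> = 2 * n - 2" "set_mset \<alpha> \<subseteq> V" for \<alpha>
      using lorentzian_coeff2[OF fin _ exW W0] that k unfolding V_def n_def by auto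
    show "(i, j) \<in> (linked V (2 * n - 2) (coeff2 E W) \<alpha>)\<^sup>*"
      if "size \<alpha> < 2 * n - 2" "set_mset \<alpha> \<subseteq> V"
        "i \<in> Domain (linked V (2 * n - 2) (coeff2 E W) \<alpha>)"
        "j \<in> Domain (linked V (2 * n - 2) (coeff2 E W) \<alpha>)" for \<alpha> i j
      using that unfolding V_def n_def
      by (intro linked_coeff2_connected[where W = W, OF fin]) (simp_all add: exW W0)
    show "0 \<le> v i" if "v \<in> set vs" for v i
      using that by (auto simp: vs_def unit_vec_def)
  qed (use V in auto)
  moreover have "derivs V vs (coeff2 E W) {#(True, None), (True, None)#} = K (a + 2) k"
    "derivs V vs (coeff2 E W) {#(False, None), (False, None)#} = K a (k + 2)"
    "derivs V vs (coeff2 E W) {#(True, None), (False, None)#} = K (a + 1) (k + 1)"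
    unfolding eval K_def by (simp_all add: add_ac numeral_2_eq_2)
  ultimately have main: "(fact (a + 2) * fact k * Z k) * (fact a * fact (k + 2) * Z (k + 2))
      \<le> (fact (a + 1) * fact (k + 1) * Z (k + 1))\<^sup>2"
    using ak by (simp add: K)
  \<comment> \<open>The factor (n - j)! j! in \<open>K\<close> is n! divided by the binomial
    coefficient, so dividing \<open>main\<close> by (n!)^2 normalizes all three sums at
    once.\<close>
  have binom: "Z j / real (card E choose j) = fact (card E - j) * fact j * Z j / fact n" if "j \<le> n" for j
    using that by (simp add: binomial_fact n_def)
  have "n - k = a + 2" "n - (k + 2) = a" "n - (k + 1) = a + 1" using ak by auto
  then show ?thesis
    using divide_right_mono[OF main, of "fact n * fact n"] ak
    unfolding n_def[symmetric] by (simp add: binom[unfolded n_def[symmetric]] power2_eq_square mult_ac)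
qed

section \<open>From M-natural-concave functions to multiplicative weights\<close>

lemma exchange_q_neg_pow:
  assumes "M_natural_concave E \<nu>" "0 < q" "q \<le> 1"
  shows "exchange E (\<lambda>I. if I \<subseteq> E then q_neg_pow q (\<nu> I) else 0)"
proof -
  \<comment> \<open>q \<le> 1 makes t \<mapsto> q^(-t) nondecreasing. If a or b is -\<infinity>, the
    left product is 0; otherwise the inequality forces c and d to be finite too.\<close>
  have mono: "q_neg_pow q a * q_neg_pow q b \<le> q_neg_pow q c * q_neg_pow q d"
    if abcd: "a + b \<le> c + d" "a \<noteq> \<infinity>" "b \<noteq> \<infinity>" "c \<noteq> \<infinity>" "d \<noteq> \<infinity>" for a b c d :: ereal
  proof (cases "a = -\<infinity> \<or> b = -\<infinity>")
    case True
    then have "q_neg_pow q a * q_neg_pow q b = 0" by (auto simp: q_neg_pow_def)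
    moreover have "0 \<le> q_neg_pow q c * q_neg_pow q d" by (simp add: q_neg_pow_def)
    ultimately show ?thesis by (simp only:)
  next
    case False
    then obtain a' b' where ab: "a = ereal a'" "b = ereal b'" using abcd by (cases a; cases b) auto
    then obtain c' d' where cd: "c = ereal c'" "d = ereal d'" using abcd ab by (cases c; cases d) auto
    have "q powr (- (a' + b')) \<le> q powr (- (c' + d'))"
      using abcd assms(2,3) unfolding ab cd by (intro powr_mono') auto
    then show ?thesis by (simp add: ab cd q_neg_pow_def flip: powr_add)
  qed
  show ?thesis
    unfolding exchange_def
  proof (intro allI impI)
    fix A B i assume AB: "A \<subseteq> E" "B \<subseteq> E" "i \<in> A - B"
    have fin: "\<nu> I \<noteq> \<infinity>" if "I \<subseteq> E" for I using assms(1) that by (simp add: M_natural_concave_def)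
    have sub: "A - {i} \<subseteq> E" "insert i B \<subseteq> E" "\<And>j. j \<in> B - A \<Longrightarrow> insert j (A - {i}) \<subseteq> E"
      "\<And>j. j \<in> B - A \<Longrightarrow> insert i (B - {j}) \<subseteq> E"
      using AB by auto
    from assms(1) AB have "\<nu> A + \<nu> B \<le> \<nu> (A - {i}) + \<nu> (B \<union> {i}) \<or>
        (\<exists>j \<in> B - A. \<nu> A + \<nu> B \<le> \<nu> ((A - {i}) \<union> {j}) + \<nu> ((B - {j}) \<union> {i}))"
      unfolding M_natural_concave_def by blast
    then consider "\<nu> A + \<nu> B \<le> \<nu> (A - {i}) + \<nu> (insert i B)"
      | j where "j \<in> B - A" "\<nu> A + \<nu> B \<le> \<nu> (insert j (A - {i})) + \<nu> (insert i (B - {j}))"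
      by auto
    then show "(if A \<subseteq> E then q_neg_pow q (\<nu> A) else 0) * (if B \<subseteq> E then q_neg_pow q (\<nu> B) else 0)
        \<le> (if A - {i} \<subseteq> E then q_neg_pow q (\<nu> (A - {i})) else 0)
          * (if insert i B \<subseteq> E then q_neg_pow q (\<nu> (insert i B)) else 0) \<or>
        (\<exists>j\<in>B - A. (if A \<subseteq> E then q_neg_pow q (\<nu> A) else 0) * (if B \<subseteq> E then q_neg_pow q (\<nu> B) else 0)
        \<le> (if insert j (A - {i}) \<subseteq> E then q_neg_pow q (\<nu> (insert j (A - {i}))) else 0)
          * (if insert i (B - {j}) \<subseteq> E then q_neg_pow q (\<nu> (insert i (B - {j}))) else 0))"
    proof cases
      case 1
      have "q_neg_pow q (\<nu> A) * q_neg_pow q (\<nu> B) \<le> q_neg_pow q (\<nu> (A - {i})) * q_neg_pow q (\<nu> (insert i B))"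
        using AB sub by (intro mono[OF 1] fin)
      then show ?thesis using AB(1,2) sub(1,2) by (simp only: if_True simp_thms)
    next
      case (2 j)
      have "q_neg_pow q (\<nu> A) * q_neg_pow q (\<nu> B)
          \<le> q_neg_pow q (\<nu> (insert j (A - {i}))) * q_neg_pow q (\<nu> (insert i (B - {j})))"
        using AB(1,2) sub(3,4)[OF 2(1)] by (intro mono[OF 2(2)] fin)
      then show ?thesis using AB(1,2) sub(3,4)[OF 2(1)] 2(1)
        by (intro disjI2 bexI[of _ j]) (simp_all only: if_True)
    qed
  qed
qed

lemma q_neg_pow_add:
  assumes "a \<noteq> \<infinity>" "b \<noteq> \<infinity>" "0 < q"
  shows "q_neg_pow q (a + b) = q_neg_pow q a * q_neg_pow q b"
  using assms by (cases a; cases b) (auto simp: q_neg_pow_def simp flip: powr_add)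

theorem theorem1:
  fixes E :: "'a set" and \<nu>1 \<nu>2 \<nu> :: "'a set \<Rightarrow> ereal" and q :: real and k :: nat
  assumes "finite E"
    and "M_natural_concave E \<nu>1"
    and "M_natural_concave E \<nu>2"
    and "\<And>I. I \<subseteq> E \<Longrightarrow> \<nu> I = \<nu>1 I + \<nu>2 I"
    and "0 < q" and "q \<le> 1"
    and "k + 2 \<le> card E"
  shows "I_sum E q \<nu> k / real (card E choose k) *
           (I_sum E q \<nu> (k + 2) / real (card E choose (k + 2)))
         \<le> (I_sum E q \<nu> (k + 1) / real (card E choose (k + 1))) ^ 2"
proof -
  define w where "w = (\<lambda>\<mu> :: 'a set \<Rightarrow> ereal. \<lambda>I. if I \<subseteq> E then q_neg_pow q (\<mu> I) else 0)"
  have "I_sum E q \<nu> j = (\<Sum>I\<in>{I. I \<subseteq> E \<and> card I = j}. w \<nu>1 I * w \<nu>2 I)" for j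
    unfolding I_sum_def
  proof (intro sum.cong refl)
    fix I assume "I \<in> {I. I \<subseteq> E \<and> card I = j}"
    then show "q_neg_pow q (\<nu> I) = w \<nu>1 I * w \<nu>2 I"
      using assms(2-5) by (simp add: w_def q_neg_pow_add M_natural_concave_def)
  qed
  moreover have "0 \<le> w \<mu> I" for \<mu> I by (simp add: w_def q_neg_pow_def)
  moreover have "exchange E (w \<nu>1)" "exchange E (w \<nu>2)"
    unfolding w_def using assms by (intro exchange_q_neg_pow; simp)+
  ultimately show ?thesis
    using common_weight_ultra_log_concave[of E "w \<nu>1" "w \<nu>2" k] assms(1,7) by simp
qed

end
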